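(* Let $Q>0$ and $K\ge1$. Suppose that $(X,\rho,\mu)$ is an unbounded Ahlfors $Q$-regular $K$-quasi-metric measure space and let $a\in X$. Then the sphericalization $(\dot X,\rho_a,\mu_a)$ of $X$ with respect to $a$ is a bounded Ahlfors $Q$-regular $K'$-quasi-metric measure space, where $K'=4K^2$.
   Context: A $K$-quasi-metric ($K\ge1$) on a set $X$ is a symmetric function $\rho:X\times X\to[0,\infty)$ with $\rho(x,y)=0$ iff $x=y$ and $\rho(x,z)\le K\max\{\rho(x,y),\rho(y,z)\}$ for all $x,y,z\in X$. Balls are $B(x,r)=\{y\in X:\rho(x,y)<r\}$. The quasi-metric space $(X,\rho)$ with positive Borel measure $\mu$ (Borel regular, with dense support) is Ahlfors $Q$-regular if there is $C\ge1$ with $C^{-1}R^Q\le\mu(B(x,R))\le CR^Q$ for all $x\in X$ and $0<R<\operatorname{diam}_\rho(X)$ (possibly $\operatorname{diam}_\rho(X)=\infty$). Sphericalization: for unbounded $(X,\rho)$ and $a\in X$, let $\dot X=X\cup\{\infty\}$ be the one-point extension and define symmetric $\rho_a$ on $\dot X\times\dot X$ by $\rho_a(x,y)=\dfrac{\rho(x,y)}{[1+\rho(x,a)][1+\rho(y,a)]}$ for $x,y\in X$, $\rho_a(x,\infty)=\rho_a(\infty,x)=\dfrac1{1+\rho(x,a)}$ for $x\in X$, and $\rho_a(\infty,\infty)=0$. The spherical measure is $\mu_a(A)=\displaystyle\int_{A\setminus\{\infty\}}\frac{1}{\mu(B(a,1+\rho(a,z)))^2}\,d\mu(z)$ for Borel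 sets $A\subset\dot X$. *)

theory Defs
  imports "HOL-Analysis.Analysis"
begin

text \<open>Only the values of \<open>\<rho>\<close> on \<open>X \<times> X\<close> are relevant in what follows.\<close>

definition quasi_metric :: "real \<Rightarrow> 'a set \<Rightarrow> ('a \<Rightarrow> 'a \<Rightarrow> real) \<Rightarrow> bool" where
  "quasi_metric K X \<rho> \<longleftrightarrow>
     1 \<le> K \<and>
     (\<forall>x\<in>X. \<forall>y\<in>X. 0 \<le> \<rho> x y) \<and>
     (\<forall>x\<in>X. \<forall>y\<in>X. \<rho> x y = \<rho> y x) \<and>
     (\<forall>x\<in>X. \<forall>y\<in>X. \<rho> x y = 0 \<longleftrightarrow> x = y) \<and>
     (\<forall>x\<in>X. \<forall>y\<in>X. \<forall>z\<in>X. \<rho> x z \<le> K * max (\<rho> x y) (\<rho> y z))"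

definition qball :: "'a set \<Rightarrow> ('a \<Rightarrow> 'a \<Rightarrow> real) \<Rightarrow> 'a \<Rightarrow> real \<Rightarrow> 'a set" where
  "qball X \<rho> x r = {y \<in> X. \<rho> x y < r}"

definition qdiam :: "'a set \<Rightarrow> ('a \<Rightarrow> 'a \<Rightarrow> real) \<Rightarrow> ereal" where
  "qdiam X \<rho> = (SUP (x, y) \<in> X \<times> X. ereal (\<rho> x y))"

definition qbounded :: "'a set \<Rightarrow> ('a \<Rightarrow> 'a \<Rightarrow> real) \<Rightarrow> bool" where
  "qbounded X \<rho> \<longleftrightarrow> qdiam X \<rho> < \<infinity>"

text \<open>A set is open iff it contains a ball around each of its points. For a quasi-metric,
  the balls themselves need be neither open nor Borel sets.\<close>

definition qtopology :: "'a set \<Rightarrow> ('a \<Rightarrow> 'a \<Rightarrow> real) \<Rightarrow> 'a topology" where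
  "qtopology X \<rho> = topology (\<lambda>U. U \<subseteq> X \<and> (\<forall>x\<in>U. \<exists>r>0. qball X \<rho> x r \<subseteq> U))"

lemma openin_qtopology:
  "openin (qtopology X \<rho>) U \<longleftrightarrow> U \<subseteq> X \<and> (\<forall>x\<in>U. \<exists>r>0. qball X \<rho> x r \<subseteq> U)"
proof -
  have "istopology (\<lambda>U. U \<subseteq> X \<and> (\<forall>x\<in>U. \<exists>r>0. qball X \<rho> x r \<subseteq> U))"
    unfolding istopology_def
  proof (intro conjI allI impI ballI, goal_cases)
    case (1 S T) then show ?case by blast
  next
    case (2 S T x)
    then obtain r s where rs: "r > 0" "qball X \<rho> x r \<subseteq> S" "s > 0" "qball X \<rho> x s \<subseteq> T"
      by blast
    moreover have "qball X \<rho> x (min r s) \<subseteq> qball X \<rho> x r \<inter> qball X \<rho> x s"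
      by (auto simp: qball_def)
    ultimately show ?case by (intro exI[of _ "min r s"]) auto
  next
    case (3 \<K>) then show ?case by blast
  next
    case (4 \<K> x)
    then obtain U r where "U \<in> \<K>" "r > 0" "qball X \<rho> x r \<subseteq> U" by blast
    then show ?case by blast
  qed
  then show ?thesis by (simp add: qtopology_def)
qed

lemma topspace_qtopology [simp]: "topspace (qtopology X \<rho>) = X"
proof -
  have "openin (qtopology X \<rho>) X"
    unfolding openin_qtopology by (auto simp: qball_def intro: exI[of _ 1])
  moreover have "topspace (qtopology X \<rho>) \<subseteq> X"
    using openin_topspace[of "qtopology X \<rho>"] unfolding openin_qtopology by blast
  ultimately show ?thesis by (meson openin_subset subset_antisym)
qed

definition qborel :: "'a set \<Rightarrow> ('a \<Rightarrow> 'a \<Rightarrow> real) \<Rightarrow> 'a set set" where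
  "qborel X \<rho> = sigma_sets X {U. openin (qtopology X \<rho>) U}"

definition qsupport :: "'a set \<Rightarrow> ('a \<Rightarrow> 'a \<Rightarrow> real) \<Rightarrow> 'a measure \<Rightarrow> 'a set" where
  "qsupport X \<rho> \<mu> = {x \<in> X. \<forall>U. openin (qtopology X \<rho>) U \<and> x \<in> U \<longrightarrow> emeasure \<mu> U > 0}"

text \<open>The measure may live on a larger \<open>\<sigma>\<close>-algebra than that of the Borel sets (such as the
  Caratheodory-measurable sets of a Borel regular outer measure). The measure of an arbitrary
  subset of \<open>X\<close>, in particular of a ball, is its outer measure \<open>outer_measure_of \<mu>\<close>; this is
  \<open>emeasure \<mu>\<close> on measurable sets.\<close>

definition quasi_metric_measure_space ::
  "real \<Rightarrow> 'a set \<Rightarrow> ('a \<Rightarrow> 'a \<Rightarrow> real) \<Rightarrow> 'a measure \<Rightarrow> bool" where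
  "quasi_metric_measure_space K X \<rho> \<mu> \<longleftrightarrow>
     quasi_metric K X \<rho> \<and>
     space \<mu> = X \<and>
     qborel X \<rho> \<subseteq> sets \<mu> \<and>
     (\<forall>A. A \<subseteq> X \<longrightarrow>
        (\<exists>B\<in>qborel X \<rho>. A \<subseteq> B \<and> emeasure \<mu> B = outer_measure_of \<mu> A)) \<and>
     (qtopology X \<rho>) closure_of (qsupport X \<rho> \<mu>) = X"

definition ahlfors_regular ::
  "real \<Rightarrow> 'a set \<Rightarrow> ('a \<Rightarrow> 'a \<Rightarrow> real) \<Rightarrow> 'a measure \<Rightarrow> bool" where
  "ahlfors_regular Q X \<rho> \<mu> \<longleftrightarrow>
     (\<exists>C::real. 1 \<le> C \<and>
       (\<forall>x\<in>X. \<forall>R::real. 0 < R \<and> ereal R < qdiam X \<rho> \<longrightarrow>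
          ennreal (inverse C * R powr Q) \<le> outer_measure_of \<mu> (qball X \<rho> x R) \<and>
          outer_measure_of \<mu> (qball X \<rho> x R) \<le> ennreal (C * R powr Q)))"

text \<open>In the one-point extension, \<open>None\<close> plays the role of \<open>\<infinity>\<close>.\<close>

definition sph_carrier :: "'a set \<Rightarrow> 'a option set" where
  "sph_carrier X = insert None (Some ` X)"

fun sph_dist :: "('a \<Rightarrow> 'a \<Rightarrow> real) \<Rightarrow> 'a \<Rightarrow> 'a option \<Rightarrow> 'a option \<Rightarrow> real" where
  "sph_dist \<rho> a (Some x) (Some y) = \<rho> x y / ((1 + \<rho> x a) * (1 + \<rho> y a))"
| "sph_dist \<rho> a (Some x) None = 1 / (1 + \<rho> x a)"
| "sph_dist \<rho> a None (Some x) = 1 / (1 + \<rho> x a)"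
| "sph_dist \<rho> a None None = 0"

text \<open>\<open>Some -` A\<close> is \<open>A - {\<infinity>}\<close>, viewed as a subset of \<open>X\<close>. The density is \<open>\<mu>\<close>-measurable as
  soon as the balls around \<open>a\<close> are; otherwise \<open>nn_integral\<close> is the lower integral, which is
  still countably additive in the domain of integration.\<close>

definition sph_measure ::
  "'a set \<Rightarrow> ('a \<Rightarrow> 'a \<Rightarrow> real) \<Rightarrow> 'a measure \<Rightarrow> 'a \<Rightarrow> 'a option measure" where
  "sph_measure X \<rho> \<mu> a =
     measure_of (sph_carrier X)
       (qborel (sph_carrier X) (sph_dist \<rho> a))
       (\<lambda>A. \<integral>\<^sup>+z \<in> (Some -` A). 1 / (outer_measure_of \<mu> (qball X \<rho> a (1 + \<rho> a z)))\<^sup>2 \<partial>\<mu>)"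

end

theory Submission
  imports Defs
begin

text \<open>
  Write \<open>N z = 1 + \<rho> z a\<close>. Since \<open>\<mu>(B(a, N z))\<close> is comparable to \<open>(N z)\<^sup>Q\<close>, the density of the spherical
  measure is comparable to \<open>(N z)\<close> to the power \<open>-2Q\<close>. When \<open>R * N x\<close> is small, \<open>N\<close> is nearly constant on
  the spherical ball \<open>B(x, R)\<close>, which is therefore comparable to the \<open>\<rho>\<close>-ball of radius \<open>R * (N x)\<^sup>2\<close>; its
  measure is about \<open>(R * (N x)\<^sup>2)\<^sup>Q\<close> times the density, i.e. \<open>R\<^sup>Q\<close>. A ball around infinity is the
  complement of a \<open>\<rho>\<close>-ball around \<open>a\<close> of radius about \<open>1 / R\<close>, and summing the density over dyadic balls
  around \<open>a\<close> bounds its measure from above. In the remaining cases one compares with a ball around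
  infinity (upper bound) or with a ball around a point \<open>y\<close> with \<open>N y\<close> about \<open>1 / R\<close> (lower bound).
  As balls need not be measurable, every estimate is made on an open set squeezed between two
  concentric balls of comparable radii. The quasi-triangle inequality for the spherical distance is a
  Ptolemy inequality for \<open>\<rho>\<close>.
\<close>

section \<open>Integrals of functions that need not be measurable\<close>

text \<open>The integral is a supremum over simple functions below \<open>f\<close>, and in
  \<open>ennreal\<close> some sequence of them already has this supremum; the pointwise supremum of
  the sequence is the required minorant.\<close>

lemma nn_integral_measurable_minorant:
  "\<exists>g\<in>borel_measurable M. g \<le> f \<and> integral\<^sup>N M g = integral\<^sup>N M f"
proof -
  let ?S = "{g. simple_function M g \<and> g \<le> f}"
  have "(\<lambda>_. 0) \<in> ?S" by (simp add: le_fun_def)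
  then have "?S \<noteq> {}" by blast
  from ennreal_SUP_countable_SUP[OF this, of "integral\<^sup>S M"]
  obtain F :: "nat \<Rightarrow> ennreal" where F: "range F \<subseteq> integral\<^sup>S M ` ?S"
    and SF: "(SUP g\<in>?S. integral\<^sup>S M g) = (SUP i. F i)"
    by auto
  have "\<forall>i. \<exists>g\<in>?S. F i = integral\<^sup>S M g" using F by blast
  then obtain g where g: "\<And>i. g i \<in> ?S" and gF: "\<And>i. F i = integral\<^sup>S M (g i)"
    by metis
  have gm: "g i \<in> borel_measurable M" for i
    using g[of i] by (auto intro: borel_measurable_simple_function)
  define h where "h = (\<lambda>x. SUP i. g i x)"
  have hm: "h \<in> borel_measurable M" unfolding h_def using gm by measurable
  have hf: "h \<le> f" using g unfolding h_def le_fun_def by (auto intro!: SUP_least)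
  have "integral\<^sup>N M f = (SUP i. F i)" using SF by (simp add: nn_integral_def)
  also have "\<dots> \<le> integral\<^sup>N M h"
  proof (rule SUP_least)
    fix i
    have "F i = integral\<^sup>N M (g i)"
      using g[of i] gF[of i] by (simp add: nn_integral_eq_simple_integral)
    also have "\<dots> \<le> integral\<^sup>N M h"
      unfolding h_def by (intro nn_integral_mono SUP_upper) auto
    finally show "F i \<le> integral\<^sup>N M h" .
  qed
  finally have "integral\<^sup>N M f \<le> integral\<^sup>N M h" .
  moreover have "integral\<^sup>N M h \<le> integral\<^sup>N M f"
    using hf by (auto intro!: nn_integral_mono simp: le_fun_def)
  ultimately show ?thesis using hm hf by (meson antisym)
qed

text \<open>Countable additivity for a possibly non-measurable \<open>f\<close>, such as the
  spherical density. In either inequality the smaller side is rewritten with measurable minorants of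
  the same integral, and for these sum and integral commute.\<close>

lemma suminf_set_nn_integral_disjoint:
  fixes A :: "nat \<Rightarrow> 'a set" and f :: "'a \<Rightarrow> ennreal"
  assumes A: "\<And>i. A i \<in> sets M" and disj: "disjoint_family A"
  shows "(\<Sum>i. \<integral>\<^sup>+x\<in>A i. f x \<partial>M) = (\<integral>\<^sup>+x\<in>(\<Union>i. A i). f x \<partial>M)"
proof (rule antisym)
  have ind: "(\<Sum>i. h * indicator (A i) x) = h * indicator (\<Union>i. A i) x" for h :: ennreal and x
    using suminf_indicator[OF disj, of x] by simp
  have "\<forall>i. \<exists>g. g \<in> borel_measurable M \<and> g \<le> (\<lambda>x. f x * indicator (A i) x) \<and>
    integral\<^sup>N M g = (\<integral>\<^sup>+x\<in>A i. f x \<partial>M)"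
    using nn_integral_measurable_minorant by blast
  then obtain g where gm: "\<And>i. g i \<in> borel_measurable M"
    and gf: "\<And>i. g i \<le> (\<lambda>x. f x * indicator (A i) x)"
    and gi: "\<And>i. integral\<^sup>N M (g i) = (\<integral>\<^sup>+x\<in>A i. f x \<partial>M)"
    by metis
  have "(\<Sum>i. \<integral>\<^sup>+x\<in>A i. f x \<partial>M) = (\<integral>\<^sup>+x. (\<Sum>i. g i x) \<partial>M)"
    using gm by (simp add: gi nn_integral_suminf)
  also have "\<dots> \<le> (\<integral>\<^sup>+x. (\<Sum>i. f x * indicator (A i) x) \<partial>M)"
    using gf by (intro nn_integral_mono suminf_le) (auto simp: le_fun_def)
  also have "\<dots> = (\<integral>\<^sup>+x\<in>(\<Union>i. A i). f x \<partial>M)"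
    by (simp only: ind)
  finally show "(\<Sum>i. \<integral>\<^sup>+x\<in>A i. f x \<partial>M) \<le> (\<integral>\<^sup>+x\<in>(\<Union>i. A i). f x \<partial>M)" .
  obtain h where hm: "h \<in> borel_measurable M"
    and hf: "h \<le> (\<lambda>x. f x * indicator (\<Union>i. A i) x)"
    and hi: "integral\<^sup>N M h = (\<integral>\<^sup>+x\<in>(\<Union>i. A i). f x \<partial>M)"
    using nn_integral_measurable_minorant by blast
  have hle: "h x * indicator (A i) x \<le> f x * indicator (A i) x" for i x
  proof (cases "x \<in> A i")
    case True
    then have "x \<in> (\<Union>i. A i)" by blast
    then show ?thesis using le_funD[OF hf, of x] True by simp
  qed simp
  \<comment> \<open>\<open>h\<close> lies below a function that vanishes off the union, so it
    vanishes there too.\<close>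
  have h0: "h x = h x * indicator (\<Union>i. A i) x" for x
    using le_funD[OF hf, of x] by (auto simp: indicator_def split: if_splits)
  have "(\<integral>\<^sup>+x\<in>(\<Union>i. A i). f x \<partial>M) = (\<integral>\<^sup>+x. (\<Sum>i. h x * indicator (A i) x) \<partial>M)"
    unfolding hi[symmetric] ind using h0 by (intro nn_integral_cong) auto
  also have "\<dots> = (\<Sum>i. \<integral>\<^sup>+x. h x * indicator (A i) x \<partial>M)"
    using hm A by (intro nn_integral_suminf) auto
  also have "\<dots> \<le> (\<Sum>i. \<integral>\<^sup>+x\<in>A i. f x \<partial>M)"
    using hle by (intro suminf_le nn_integral_mono) auto
  finally show "(\<integral>\<^sup>+x\<in>(\<Union>i. A i). f x \<partial>M) \<le> (\<Sum>i. \<integral>\<^sup>+x\<in>A i. f x \<partial>M)" .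
qed

section \<open>Balls and open sets of a quasi-metric\<close>

lemma quasi_metricD:
  assumes "quasi_metric K X \<rho>"
  shows quasi_metric_ge_1: "1 \<le> K"
    and quasi_metric_nonneg: "\<lbrakk>x \<in> X; y \<in> X\<rbrakk> \<Longrightarrow> 0 \<le> \<rho> x y"
    and quasi_metric_commute: "\<lbrakk>x \<in> X; y \<in> X\<rbrakk> \<Longrightarrow> \<rho> x y = \<rho> y x"
    and quasi_metric_eq_0: "\<lbrakk>x \<in> X; y \<in> X\<rbrakk> \<Longrightarrow> \<rho> x y = 0 \<longleftrightarrow> x = y"
    and quasi_metric_triangle: "\<lbrakk>x \<in> X; y \<in> X; z \<in> X\<rbrakk> \<Longrightarrow> \<rho> x z \<le> K * max (\<rho> x y) (\<rho> y z)"
  using assms unfolding quasi_metric_def by blast+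

fun qchain :: "'a set \<Rightarrow> ('a \<Rightarrow> 'a \<Rightarrow> real) \<Rightarrow> real \<Rightarrow> nat \<Rightarrow> 'a \<Rightarrow> real \<Rightarrow> 'a set" where
  "qchain X \<rho> K 0 x r = {x}"
| "qchain X \<rho> K (Suc n) x r = (\<Union>z\<in>qball X \<rho> x (r / K). qchain X \<rho> K n z (r / K))"

text \<open>The first step is shorter than \<open>r / K\<close> and, by induction, the remaining
  chain ends within \<open>r / K\<close> of its start. The quasi-triangle inequality takes the
  maximum of the two and multiplies by \<open>K\<close>, so the chain stays within \<open>r\<close>
  whatever its length.\<close>

lemma qchain_subset_qball:
  assumes "quasi_metric K X \<rho>" "x \<in> X" "r > 0"
  shows "qchain X \<rho> K n x r \<subseteq> qball X \<rho> x r"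
  using assms(2,3)
proof (induction n arbitrary: x r)
  case 0
  then show ?case using quasi_metric_eq_0[OF assms(1), of x x] by (simp add: qball_def)
next
  case (Suc n)
  have K: "1 \<le> K" using quasi_metric_ge_1[OF assms(1)] .
  show ?case
  proof
    fix w assume "w \<in> qchain X \<rho> K (Suc n) x r"
    then obtain z where z: "z \<in> X" "\<rho> x z < r / K" "w \<in> qchain X \<rho> K n z (r / K)"
      by (auto simp: qball_def)
    then have w: "w \<in> X" "\<rho> z w < r / K"
      using Suc.IH[of z "r / K"] Suc.prems K by (auto simp: qball_def)
    have "\<rho> x w \<le> K * max (\<rho> x z) (\<rho> z w)"
      using quasi_metric_triangle[OF assms(1)] Suc.prems z w by blast
    also have "\<dots> < K * (r / K)" using z w K by (intro mult_strict_left_mono) auto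
    finally show "w \<in> qball X \<rho> x r" using w K by (simp add: qball_def)
  qed
qed

text \<open>A further step can be appended at the end of a chain. This is what makes the union over
  all lengths open.\<close>

lemma qball_subset_qchain:
  assumes "w \<in> qchain X \<rho> K n x r"
  shows "qball X \<rho> w (r / K ^ Suc n) \<subseteq> qchain X \<rho> K (Suc n) x r"
  using assms
proof (induction n arbitrary: x r)
  case 0
  then show ?case by auto
next
  case (Suc n)
  then obtain z where z: "z \<in> qball X \<rho> x (r / K)" "w \<in> qchain X \<rho> K n z (r / K)"
    by auto
  have "qball X \<rho> w (r / K ^ Suc (Suc n)) \<subseteq> qchain X \<rho> K (Suc n) z (r / K)"
    using Suc.IH[OF z(2)] by (simp add: field_simps)
  then show ?case using z(1) by (subst qchain.simps) blast
qed

text \<open>Balls of a quasi-metric need not be neighbourhoods of their points a priori. The points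
  reachable by chains with step sizes \<open>r / K, r / K\<^sup>2, \<dots>\<close> form an open set inside the ball.\<close>

lemma open_between_qballs:
  assumes qm: "quasi_metric K X \<rho>" and x: "x \<in> X" and r: "r > 0"
  obtains U where "openin (qtopology X \<rho>) U" "qball X \<rho> x (r / K) \<subseteq> U" "U \<subseteq> qball X \<rho> x r"
proof
  let ?U = "\<Union>n. qchain X \<rho> K n x r"
  have K: "1 \<le> K" using quasi_metric_ge_1[OF qm] .
  show sub: "?U \<subseteq> qball X \<rho> x r" using qchain_subset_qball[OF qm x r] by blast
  have "\<exists>s>0. qball X \<rho> w s \<subseteq> ?U" if "w \<in> qchain X \<rho> K n x r" for w n
  proof (intro exI conjI)
    show "0 < r / K ^ Suc n" using r K by simp
    show "qball X \<rho> w (r / K ^ Suc n) \<subseteq> ?U" using qball_subset_qchain[OF that] by blast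
  qed
  then show "openin (qtopology X \<rho>) ?U"
    unfolding openin_qtopology using sub by (auto simp: qball_def)
  have "qball X \<rho> x (r / K) \<subseteq> qchain X \<rho> K 1 x r" by auto
  then show "qball X \<rho> x (r / K) \<subseteq> ?U" by blast
qed

lemma qborel_openin: "openin (qtopology X \<rho>) U \<Longrightarrow> U \<in> qborel X \<rho>"
  by (simp add: qborel_def sigma_sets.Basic)

lemma sigma_algebra_qborel: "sigma_algebra X (qborel X \<rho>)"
  unfolding qborel_def by (rule sigma_algebra_sigma_sets) (auto simp: openin_qtopology)

text \<open>Split according to which of \<open>p, q, u, v\<close> is the smallest.\<close>

lemma quasi_ptolemy:
  fixes p q u v s t K :: real
  assumes K: "1 \<le> K" and nn: "0 \<le> p" "0 \<le> q" "0 \<le> u" "0 \<le> v" "0 \<le> s" "0 \<le> t"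
    and tri: "s \<le> K * max p u" "s \<le> K * max q v" "t \<le> K * max p v" "t \<le> K * max u q"
  shows "s * t \<le> K\<^sup>2 * max (p * q) (u * v)"
proof -
  have *: "s * t \<le> K\<^sup>2 * max (p * q) (u * v)"
    if "0 \<le> b" "0 \<le> c" "s \<le> K * b" "t \<le> K * c" "b * c \<le> max (p * q) (u * v)" for b c
  proof -
    have "s * t \<le> (K * b) * (K * c)" using that nn K by (intro mult_mono) auto
    also have "\<dots> = K\<^sup>2 * (b * c)" by (simp add: power2_eq_square)
    also have "\<dots> \<le> K\<^sup>2 * max (p * q) (u * v)" using that by (intro mult_left_mono) auto
    finally show ?thesis .
  qed
  consider "p \<le> u" "p \<le> v" | "q \<le> u" "q \<le> v" | "u \<le> p" "u \<le> q" | "v \<le> p" "v \<le> q"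
    by linarith
  then show ?thesis
  proof cases
    case 1 then show ?thesis using * [of u v] tri nn by (auto simp: max_def)
  next
    case 2 then show ?thesis using *[of v u] tri nn by (auto simp: max_def mult.commute)
  next
    case 3 then show ?thesis using *[of p q] tri nn by (auto simp: max_def)
  next
    case 4 then show ?thesis using *[of q p] tri nn by (auto simp: max_def mult.commute)
  qed
qed

text \<open>Turns bounds on the measure of a ball into bounds on the spherical density. The
  hypotheses force \<open>m\<close> to be a positive real, so the division can be carried out in the
  reals.\<close>

lemma inverse_square_bounds_ennreal:
  fixes l u :: real
  assumes "0 < l" "ennreal l \<le> m" "m \<le> ennreal u"
  shows "ennreal (1 / u\<^sup>2) \<le> 1 / m\<^sup>2" and "1 / m\<^sup>2 \<le> ennreal (1 / l\<^sup>2)"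
proof -
  obtain c where c: "m = ennreal c" "0 \<le> c"
    using assms(3) by (metis ennreal_enn2real enn2real_nonneg ennreal_less_top leD le_less_linear order.strict_trans1)
  then have lc: "l \<le> c" using assms by (simp add: ennreal_le_iff)
  have cu: "c \<le> u" using assms c lc by (metis ennreal_le_iff2 not_le order.strict_trans2)
  have "1 / m\<^sup>2 = ennreal (1 / c\<^sup>2)"
    using c lc assms(1) by (simp add: ennreal_power divide_ennreal flip: ennreal_1)
  moreover have "1 / u\<^sup>2 \<le> 1 / c\<^sup>2" "1 / c\<^sup>2 \<le> 1 / l\<^sup>2"
    using assms(1) lc cu by (auto intro!: divide_left_mono power_mono)
  ultimately show "ennreal (1 / u\<^sup>2) \<le> 1 / m\<^sup>2" "1 / m\<^sup>2 \<le> ennreal (1 / l\<^sup>2)"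
    by (auto intro: ennreal_leI)
qed

section \<open>The spherical distance\<close>

text \<open>The ball bounds carry no restriction by the diameter, since the diameter of an unbounded
  space is infinite.\<close>

locale ahlfors_space =
  fixes X :: "'a set" and \<rho> :: "'a \<Rightarrow> 'a \<Rightarrow> real" and \<mu> :: "'a measure"
    and a :: 'a and Q K C :: real
  assumes Q_pos: "0 < Q" and C_ge_1: "1 \<le> C"
    and qm: "quasi_metric K X \<rho>"
    and space_\<mu>: "space \<mu> = X"
    and qborel_sets: "qborel X \<rho> \<subseteq> sets \<mu>"
    and a_in: "a \<in> X"
    and ball_lower: "\<And>x r. \<lbrakk>x \<in> X; 0 < r\<rbrakk> \<Longrightarrow>
      ennreal (inverse C * r powr Q) \<le> outer_measure_of \<mu> (qball X \<rho> x r)"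
    and ball_upper: "\<And>x r. \<lbrakk>x \<in> X; 0 < r\<rbrakk> \<Longrightarrow>
      outer_measure_of \<mu> (qball X \<rho> x r) \<le> ennreal (C * r powr Q)"
begin

text \<open>The reciprocal of \<open>N z\<close> is the spherical distance from \<open>z\<close> to
  infinity.\<close>

abbreviation "N z \<equiv> 1 + \<rho> z a"
abbreviation "\<sigma> \<equiv> sph_dist \<rho> a"
abbreviation "Y \<equiv> sph_carrier X"
abbreviation "\<nu> \<equiv> sph_measure X \<rho> \<mu> a"
abbreviation "dens z \<equiv> 1 / (outer_measure_of \<mu> (qball X \<rho> a (1 + \<rho> a z)))\<^sup>2"

lemmas K_ge_1 = quasi_metric_ge_1[OF qm]
  and nonneg = quasi_metric_nonneg[OF qm]
  and comm = quasi_metric_commute[OF qm]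
  and eq_0 = quasi_metric_eq_0[OF qm]
  and tri = quasi_metric_triangle[OF qm]

lemma N_ge_1: "x \<in> X \<Longrightarrow> 1 \<le> N x"
  using nonneg[of x a] a_in by simp

lemma dist_le_N: "\<lbrakk>x \<in> X; y \<in> X\<rbrakk> \<Longrightarrow> \<rho> x y \<le> K * max (N x) (N y)"
proof -
  assume xy: "x \<in> X" "y \<in> X"
  have "\<rho> x y \<le> K * max (\<rho> x a) (\<rho> y a)" using tri[of x a y] comm[of a y] xy a_in by simp
  also have "\<dots> \<le> K * max (N x) (N y)" using K_ge_1 by (intro mult_left_mono) auto
  finally show ?thesis .
qed

text \<open>\<open>max 1 (\<rho> x a)\<close> behaves like the distance from \<open>x\<close> to a
  fictitious extra point, with the same constant \<open>K\<close>. It agrees with \<open>N x\<close>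
  up to a factor 2.\<close>

lemma max_1_dist_le:
  assumes "x \<in> X" "y \<in> X"
  shows "max 1 (\<rho> y a) \<le> K * max (\<rho> x y) (max 1 (\<rho> x a))"
proof -
  have "\<rho> y a \<le> K * max (\<rho> x y) (\<rho> x a)" using tri[of y x a] comm[of y x] assms a_in by simp
  also have "\<dots> \<le> K * max (\<rho> x y) (max 1 (\<rho> x a))" using K_ge_1 by (intro mult_left_mono) auto
  finally have "\<rho> y a \<le> K * max (\<rho> x y) (max 1 (\<rho> x a))" .
  moreover have "1 * 1 \<le> K * max (\<rho> x y) (max 1 (\<rho> x a))"
    using K_ge_1 by (intro mult_mono) auto
  ultimately show ?thesis by simp
qed

lemma N_le:
  assumes "x \<in> X" "y \<in> X"
  shows "N y \<le> 2 * K * max (N x) (\<rho> x y)"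
proof -
  have "N y \<le> 2 * max 1 (\<rho> y a)" by simp
  also have "\<dots> \<le> 2 * (K * max (\<rho> x y) (max 1 (\<rho> x a)))" using max_1_dist_le[OF assms] by simp
  also have "\<dots> \<le> 2 * (K * max (N x) (\<rho> x y))"
    using K_ge_1 N_ge_1[OF assms(1)] by (intro mult_left_mono) auto
  finally show ?thesis by (simp add: mult.assoc)
qed

text \<open>This is \<open>quasi_ptolemy\<close> for \<open>x\<close>, \<open>y\<close>,
  \<open>z\<close> and the fictitious point at distance \<open>max 1 (\<rho> x a)\<close> from
  \<open>x\<close>. Replacing that distance by \<open>N\<close> costs a factor 2 on the left and
  nothing on the right.\<close>

lemma ptolemy_N:
  assumes "x \<in> X" "y \<in> X" "z \<in> X"
  shows "\<rho> x z * N y \<le> 4 * K\<^sup>2 * max (\<rho> x y * N z) (\<rho> y z * N x)"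
proof -
  let ?s = "\<lambda>x. max 1 (\<rho> x a)"
  have xz: "\<rho> x z \<le> K * max (?s z) (?s x)"
  proof -
    have "\<rho> x z \<le> K * max (\<rho> x a) (\<rho> z a)" using tri[of x a z] comm[of a z] assms a_in by simp
    also have "\<dots> \<le> K * max (?s z) (?s x)" using K_ge_1 by (intro mult_left_mono) auto
    finally show ?thesis .
  qed
  have "\<rho> x z * N y \<le> \<rho> x z * (2 * ?s y)"
    using nonneg assms by (intro mult_left_mono) auto
  also have "\<dots> = 2 * (\<rho> x z * ?s y)" by simp
  also have "\<rho> x z * ?s y \<le> K\<^sup>2 * max (\<rho> x y * ?s z) (\<rho> y z * ?s x)"
    using tri[of x y z] max_1_dist_le[of x y] max_1_dist_le[of z y] comm[of y z] xz nonneg K_ge_1 assms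
    by (intro quasi_ptolemy) (auto simp: max.commute)
  also have "\<dots> \<le> K\<^sup>2 * max (\<rho> x y * N z) (\<rho> y z * N x)"
    using nonneg assms a_in by (intro mult_left_mono max.mono) auto
  finally have "\<rho> x z * N y \<le> 2 * (K\<^sup>2 * max (\<rho> x y * N z) (\<rho> y z * N x))" by simp
  moreover have "0 \<le> K\<^sup>2 * max (\<rho> x y * N z) (\<rho> y z * N x)"
  proof (rule mult_nonneg_nonneg)
    have "0 \<le> \<rho> x y * N z" using nonneg assms a_in by (intro mult_nonneg_nonneg) auto
    then show "0 \<le> max (\<rho> x y * N z) (\<rho> y z * N x)" by (rule max.coboundedI1)
  qed simp
  ultimately show ?thesis by simp
qed

lemma sigma_commute: "\<lbrakk>x \<in> Y; y \<in> Y\<rbrakk> \<Longrightarrow> \<sigma> x y = \<sigma> y x"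
  using comm by (auto simp: sph_carrier_def mult.commute)

text \<open>After clearing denominators, three finite points lead to \<open>ptolemy_N\<close>,
  infinity as one of the outer points leads to \<open>N_le\<close>, and infinity as the middle point
  leads to \<open>dist_le_N\<close>.\<close>

lemma sigma_triangle:
  assumes "x \<in> Y" "y \<in> Y" "z \<in> Y"
  shows "\<sigma> x z \<le> 4 * K\<^sup>2 * max (\<sigma> x y) (\<sigma> y z)"
proof -
  have K2: "1 \<le> K\<^sup>2" using K_ge_1 by simp
  have KK: "K \<le> K\<^sup>2" using K_ge_1 by (simp add: power2_eq_square)
  have sn: "0 \<le> \<sigma> u v" if "u \<in> Y" "v \<in> Y" for u v
    using that nonneg N_ge_1 a_in by (auto simp: sph_carrier_def)
  have pos: "0 < N u" if "u \<in> X" for u using N_ge_1[OF that] by simp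
  have None_Some: "\<sigma> None (Some w) \<le> 4 * K\<^sup>2 * max (\<sigma> None (Some v)) (\<sigma> (Some v) (Some w))"
    if "v \<in> X" "w \<in> X" for v w
  proof -
    have "N v \<le> 2 * K * max (N w) (\<rho> v w)" using N_le[OF that(2,1)] comm[OF that] by simp
    also have "\<dots> \<le> 4 * K\<^sup>2 * max (N w) (\<rho> v w)"
      using KK K_ge_1 N_ge_1[OF that(2)] by (intro mult_right_mono) auto
    finally have *: "N v \<le> 4 * K\<^sup>2 * max (N w) (\<rho> v w)" .
    have "\<sigma> None (Some w) = N v / (N v * N w)" using pos[OF that(1)] by simp
    also have "\<dots> \<le> 4 * K\<^sup>2 * max (N w) (\<rho> v w) / (N v * N w)"
      using * pos that by (intro divide_right_mono) (auto simp: less_imp_le)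
    also have "\<dots> = 4 * K\<^sup>2 * max (\<sigma> None (Some v)) (\<sigma> (Some v) (Some w))"
      using pos[OF that(1)] pos[OF that(2)] by (auto simp: max_def divide_simps)
    finally show ?thesis .
  qed
  consider "x = None" "z = None" | "y = None" "x = None" | "y = None" "z = None"
    | v w where "x = None" "y = Some v" "z = Some w" "v \<in> X" "w \<in> X"
    | v w where "z = None" "y = Some v" "x = Some w" "v \<in> X" "w \<in> X"
    | u w where "y = None" "x = Some u" "z = Some w" "u \<in> X" "w \<in> X"
    | u v w where "x = Some u" "y = Some v" "z = Some w" "u \<in> X" "v \<in> X" "w \<in> X"
    using assms unfolding sph_carrier_def by blast
  then show ?thesis
  proof cases
    case 1
    then show ?thesis using K2 sn[OF assms(1,2)] by (auto simp: le_max_iff_disj)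
  next
    case 2
    have "1 * \<sigma> y z \<le> 4 * K\<^sup>2 * max (\<sigma> x y) (\<sigma> y z)"
      using K2 sn[OF assms(2,3)] by (intro mult_mono) auto
    with 2 show ?thesis by simp
  next
    case 3
    have "1 * \<sigma> x y \<le> 4 * K\<^sup>2 * max (\<sigma> x y) (\<sigma> y z)"
      using K2 sn[OF assms(1,2)] by (intro mult_mono) auto
    with 3 show ?thesis by simp
  next
    case 4
    then show ?thesis using None_Some by blast
  next
    case 5
    have "\<sigma> None (Some w) \<le> 4 * K\<^sup>2 * max (\<sigma> None (Some v)) (\<sigma> (Some v) (Some w))"
      using None_Some 5 by blast
    then show ?thesis using 5 comm[of v w] by (simp add: max.commute mult.commute)
  next
    case 6
    have "\<rho> u w \<le> K * max (N u) (N w)" using dist_le_N 6 by blast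
    also have "\<dots> \<le> 4 * K\<^sup>2 * max (N u) (N w)"
      using KK K_ge_1 N_ge_1 6 by (intro mult_right_mono) (auto simp: le_max_iff_disj intro: order.trans[OF zero_le_one])
    finally have "\<rho> u w \<le> 4 * K\<^sup>2 * max (N u) (N w)" .
    then have "\<rho> u w / (N u * N w) \<le> 4 * K\<^sup>2 * max (N u) (N w) / (N u * N w)"
      using pos 6 by (intro divide_right_mono) (auto simp: less_imp_le)
    also have "\<dots> = 4 * K\<^sup>2 * max (\<sigma> x y) (\<sigma> y z)"
      using pos[of u] pos[of w] 6 by (auto simp: max_def divide_simps)
    finally show ?thesis using 6 by simp
  next
    case 7
    have "\<rho> u w / (N u * N w) = \<rho> u w * N v / (N u * N v * N w)" using pos[of v] 7 by simp
    also have "\<dots> \<le> 4 * K\<^sup>2 * max (\<rho> u v * N w) (\<rho> v w * N u) / (N u * N v * N w)"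
      using ptolemy_N 7 pos by (intro divide_right_mono) (auto simp: less_imp_le)
    also have "\<dots> = 4 * K\<^sup>2 * max (\<sigma> x y) (\<sigma> y z)"
      using pos[of u] pos[of v] pos[of w] 7 by (auto simp: max_def divide_simps)
    finally show ?thesis using 7 by simp
  qed
qed

lemma quasi_metric_sph: "quasi_metric (4 * K\<^sup>2) Y \<sigma>"
  unfolding quasi_metric_def
proof (intro conjI ballI)
  have "1 \<le> K\<^sup>2" using K_ge_1 by simp
  then show "1 \<le> 4 * K\<^sup>2" by simp
  show "0 \<le> \<sigma> x y" if "x \<in> Y" "y \<in> Y" for x y
    using that nonneg N_ge_1 a_in by (auto simp: sph_carrier_def)
  show "(\<sigma> x y = 0) = (x = y)" if "x \<in> Y" "y \<in> Y" for x y
  proof -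
    have "N u \<noteq> 0" if "u \<in> X" for u using N_ge_1[OF that] by linarith
    then show ?thesis using that eq_0 by (auto simp: sph_carrier_def)
  qed
qed (use sigma_commute sigma_triangle in blast)+

text \<open>Since \<open>N\<close> is at least 1, \<open>max (N u) (N v)\<close> is at most
  \<open>N u * N v\<close>, and \<open>dist_le_N\<close> applies. Besides boundedness, this limits
  the radii for which lower bounds are required to \<open>R \<le> K\<close>.\<close>

lemma sigma_le_K:
  assumes "x \<in> Y" "y \<in> Y"
  shows "\<sigma> x y \<le> K"
proof -
  have inv: "1 / N u \<le> K" if "u \<in> X" for u
  proof -
    have "1 / N u \<le> 1" using N_ge_1[OF that] by simp
    then show ?thesis using K_ge_1 by linarith
  qed
  have "\<rho> u v / (N u * N v) \<le> K" if "u \<in> X" "v \<in> X" for u v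
  proof -
    have "max (N u) (N v) \<le> N u * N v"
      using mult_mono[of 1 "N u" "N v" "N v"] mult_mono[of "N u" "N u" 1 "N v"] N_ge_1 that by auto
    then have "K * max (N u) (N v) \<le> K * (N u * N v)" using K_ge_1 by (intro mult_left_mono) auto
    then have "\<rho> u v \<le> K * (N u * N v)" using dist_le_N[OF that] by linarith
    moreover have "0 < N u * N v" using N_ge_1[OF that(1)] N_ge_1[OF that(2)] by (intro mult_pos_pos) auto
    ultimately show ?thesis by (simp add: divide_le_eq)
  qed
  then show ?thesis using assms inv K_ge_1 by (auto simp: sph_carrier_def)
qed

lemma qdiam_sph_le: "qdiam Y \<sigma> \<le> ereal K"
  unfolding qdiam_def using sigma_le_K by (auto intro!: SUP_least)

section \<open>The spherical measure and its density\<close>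

text \<open>Dividing by \<open>N x * N y\<close>, which is at least 1, does not increase distances,
  so \<open>Some\<close> is continuous.\<close>

lemma openin_vimage_Some:
  assumes "openin (qtopology Y \<sigma>) U"
  shows "openin (qtopology X \<rho>) (Some -` U)"
  unfolding openin_qtopology
proof (intro conjI ballI)
  have UY: "U \<subseteq> Y" using assms by (simp add: openin_qtopology)
  then show "Some -` U \<subseteq> X" by (auto simp: sph_carrier_def)
  fix x assume x: "x \<in> Some -` U"
  then have xX: "x \<in> X" using UY by (auto simp: sph_carrier_def)
  obtain r where r: "r > 0" "qball Y \<sigma> (Some x) r \<subseteq> U"
    using assms x unfolding openin_qtopology by auto
  have "\<sigma> (Some x) (Some y) \<le> \<rho> x y" if "y \<in> X" for y
  proof -
    have "1 * 1 \<le> N x * N y" using N_ge_1 xX that by (intro mult_mono) auto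
    then have "\<rho> x y / (N x * N y) \<le> \<rho> x y / 1" using nonneg xX that by (intro divide_left_mono) auto
    then show ?thesis by simp
  qed
  then have "qball X \<rho> x r \<subseteq> Some -` U"
    using r(2) by (force simp: qball_def sph_carrier_def)
  then show "\<exists>r>0. qball X \<rho> x r \<subseteq> Some -` U" using r(1) by blast
qed

lemma vimage_Some_sets:
  assumes "A \<in> qborel Y \<sigma>"
  shows "Some -` A \<in> sets \<mu>"
  using assms unfolding qborel_def
proof induction
  case (Basic U)
  then show ?case using openin_vimage_Some qborel_openin qborel_sets by blast
next
  case (Compl A)
  have "Some -` (Y - A) = space \<mu> - Some -` A"
    by (auto simp: space_\<mu> sph_carrier_def)
  then show ?case using Compl by simp
next
  case (Union A)
  then show ?case by (auto simp: vimage_UN)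
qed simp

lemma sets_sph: "sets \<nu> = qborel Y \<sigma>"
  unfolding sph_measure_def
  by (rule sigma_algebra.sets_measure_of_eq[OF sigma_algebra_qborel])

lemma space_sph: "space \<nu> = Y"
  unfolding sph_measure_def
  by (rule sigma_algebra.space_measure_of_eq[OF sigma_algebra_qborel])

text \<open>\<open>measure_of\<close> returns the given set function only if that function is
  countably additive on the Borel sets. This holds by
  \<open>suminf_set_nn_integral_disjoint\<close>, whether or not the density is measurable.\<close>

lemma emeasure_sph:
  assumes "A \<in> qborel Y \<sigma>"
  shows "emeasure \<nu> A = (\<integral>\<^sup>+z\<in>(Some -` A). dens z \<partial>\<mu>)"
  unfolding sph_measure_def
proof (rule emeasure_measure_of_sigma[OF sigma_algebra_qborel _ _ assms])
  show "positive (qborel Y \<sigma>) (\<lambda>A. \<integral>\<^sup>+z\<in>(Some -` A). dens z \<partial>\<mu>)"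
    by (simp add: positive_def)
  show "countably_additive (qborel Y \<sigma>) (\<lambda>A. \<integral>\<^sup>+z\<in>(Some -` A). dens z \<partial>\<mu>)"
  proof (rule countably_additiveI)
    fix A :: "nat \<Rightarrow> 'a option set"
    assume A: "range A \<subseteq> qborel Y \<sigma>" "disjoint_family A"
    have "disjoint_family (\<lambda>i. Some -` A i)"
      using A(2) by (fastforce simp: disjoint_family_on_def)
    then show "(\<Sum>i. \<integral>\<^sup>+z\<in>(Some -` A i). dens z \<partial>\<mu>) = (\<integral>\<^sup>+z\<in>(Some -` (\<Union>i. A i)). dens z \<partial>\<mu>)"
      unfolding vimage_UN using A(1) vimage_Some_sets
      by (intro suminf_set_nn_integral_disjoint) auto
  qed
qed

text \<open>Regularity at \<open>a\<close> with radius \<open>N z\<close> gives both bounds. The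
  power is written as \<open>(1 / (N z)\<^sup>2) powr Q\<close> so that it merges with a factor
  \<open>s powr Q\<close> through \<open>powr_mult\<close>.\<close>

lemma
  assumes "z \<in> X"
  shows dens_lower: "ennreal ((1 / (N z)\<^sup>2) powr Q / C\<^sup>2) \<le> dens z"
    and dens_upper: "dens z \<le> ennreal (C\<^sup>2 * (1 / (N z)\<^sup>2) powr Q)"
proof -
  have N: "0 < N z" "1 + \<rho> a z = N z" using N_ge_1[OF assms] comm[OF a_in assms] by auto
  have sq: "(1 / (N z)\<^sup>2) powr Q = 1 / (N z powr Q)\<^sup>2"
    using N by (simp add: powr_divide power2_eq_square powr_mult)
  have C: "0 < C" using C_ge_1 by simp
  have eq: "1 / (C * N z powr Q)\<^sup>2 = (1 / (N z)\<^sup>2) powr Q / C\<^sup>2"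
    "1 / (inverse C * N z powr Q)\<^sup>2 = C\<^sup>2 * (1 / (N z)\<^sup>2) powr Q"
    unfolding sq using C N by (auto simp: power_mult_distrib field_simps)
  have "0 < inverse C * N z powr Q" using C N by simp
  from inverse_square_bounds_ennreal[OF this ball_lower[OF a_in N(1)] ball_upper[OF a_in N(1)]]
  show "ennreal ((1 / (N z)\<^sup>2) powr Q / C\<^sup>2) \<le> dens z"
    "dens z \<le> ennreal (C\<^sup>2 * (1 / (N z)\<^sup>2) powr Q)"
    unfolding eq N(2) by auto
qed

section \<open>Balls that are small compared with their distance from infinity\<close>

text \<open>If \<open>N z\<close> exceeded \<open>2 * K * N x\<close>, then \<open>N_le\<close>
  would give \<open>N z \<le> 2 * K * \<rho> x z\<close>, while nearness and the smallness of
  \<open>R * N x\<close> give the opposite strict inequality. The bound on \<open>\<rho> x z\<close>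
  follows, and it excludes the second alternative of \<open>N_le\<close> with \<open>x\<close> and
  \<open>z\<close> exchanged.\<close>

lemma
  assumes "x \<in> X" "z \<in> X" and near: "\<sigma> (Some x) (Some z) < R" and R: "4 * K\<^sup>2 * R * N x \<le> 1"
  shows near_N_le: "N z \<le> 2 * K * N x"
    and near_N_ge: "N x \<le> 2 * K * N z"
    and near_dist: "\<rho> x z < 2 * K * R * (N x)\<^sup>2"
proof -
  have Nx: "1 \<le> N x" and Nz: "1 \<le> N z" using N_ge_1 assms by auto
  have K: "1 \<le> K" by (rule K_ge_1)
  have "\<rho> x z / (N x * N z) < R" using near by simp
  then have d: "\<rho> x z < R * N x * N z" using Nx Nz by (simp add: divide_less_eq mult.assoc)
  have "0 \<le> R * (N x * N z)" using d nonneg[of x z] assms by (simp add: mult.assoc)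
  moreover have "0 < N x * N z" using Nx Nz by (intro mult_pos_pos) auto
  ultimately have R0: "0 \<le> R" by (simp only: zero_le_mult_iff) linarith
  have RN: "0 \<le> R * N x" using R0 Nx by simp
  have "2 * K * (R * N x) \<le> 4 * K\<^sup>2 * (R * N x)"
    using K RN by (intro mult_right_mono) (auto simp: power2_eq_square)
  also have "\<dots> = 4 * K\<^sup>2 * R * N x" by (simp only: mult.assoc)
  finally have R2: "2 * K * (R * N x) \<le> 1" using R by (rule order.trans)
  show z: "N z \<le> 2 * K * N x"
  proof (rule ccontr)
    assume "\<not> ?thesis"
    then have *: "N z \<le> 2 * K * \<rho> x z"
      using N_le[OF assms(1,2)] by (auto simp: max_def split: if_splits)
    have "R * N x * N z \<le> R * N x * (2 * K * \<rho> x z)" using * RN by (intro mult_left_mono) auto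
    also have "\<dots> = 2 * K * (R * N x) * \<rho> x z" by simp
    also have "\<dots> \<le> 1 * \<rho> x z" using R2 nonneg assms by (intro mult_right_mono) auto
    finally show False using d by simp
  qed
  have "R * N x * N z \<le> R * N x * (2 * K * N x)" using z RN by (intro mult_left_mono) auto
  then show dist: "\<rho> x z < 2 * K * R * (N x)\<^sup>2" using d by (simp add: power2_eq_square algebra_simps)
  have "2 * K * \<rho> x z < 2 * K * (2 * K * R * (N x)\<^sup>2)" using dist K by (intro mult_strict_left_mono) auto
  also have "\<dots> = (4 * K\<^sup>2 * R * N x) * N x" by (simp add: power2_eq_square)
  also have "\<dots> \<le> 1 * N x" using R Nx by (intro mult_right_mono) auto
  finally have "2 * K * \<rho> x z < N x" by simp
  then show "N x \<le> 2 * K * N z"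
    using N_le[OF assms(2,1)] comm[OF assms(1,2)] by (auto simp: max_def split: if_splits)
qed

text \<open>By \<open>N_le\<close> the assumed bound on \<open>\<rho> x z\<close> already makes
  \<open>N x\<close> at most \<open>2 * K * N z\<close>, so one factor \<open>N x\<close> of the
  bound can be traded for \<open>N z\<close>. This places a ball of \<rho> inside a spherical
  ball.\<close>

lemma near_converse:
  assumes "x \<in> X" "z \<in> X" and R: "R * N x \<le> 1" and d: "\<rho> x z < R * (N x)\<^sup>2 / (2 * K)"
  shows "\<sigma> (Some x) (Some z) < R"
proof -
  have Nx: "1 \<le> N x" and Nz: "1 \<le> N z" using N_ge_1 assms by auto
  have K: "1 \<le> K" by (rule K_ge_1)
  have d': "2 * K * \<rho> x z < R * (N x)\<^sup>2" using d K by (simp add: field_simps)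
  have "R * (N x)\<^sup>2 = (R * N x) * N x" by (simp add: power2_eq_square)
  also have "\<dots> \<le> 1 * N x" using R Nx by (intro mult_right_mono) auto
  finally have "N x \<le> 2 * K * N z"
    using d' N_le[OF assms(2,1)] comm[OF assms(1,2)] by (auto simp: max_def split: if_splits)
  then have "\<rho> x z * N x \<le> \<rho> x z * (2 * K * N z)"
    using nonneg assms by (intro mult_left_mono) auto
  also have "\<dots> = 2 * K * \<rho> x z * N z" by simp
  also have "\<dots> < R * (N x)\<^sup>2 * N z" using d' Nz by (intro mult_strict_right_mono) auto
  also have "\<dots> = R * (N x * N z) * N x" by (simp add: power2_eq_square)
  finally have "\<rho> x z < R * (N x * N z)" using Nx by (simp add: mult.commute[of "N x" "N z"])
  moreover have "0 < N x * N z" using Nx Nz by (intro mult_pos_pos) auto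
  ultimately have "\<rho> x z / (N x * N z) < R" by (simp only: pos_divide_less_eq)
  then show ?thesis by simp
qed

text \<open>The density is at most \<open>C\<^sup>2 * (1 / m\<^sup>2) powr Q\<close> on
  \<open>V\<close>, and the enclosing ball has measure at most \<open>C * s powr Q\<close>.\<close>

lemma emeasure_sph_le:
  assumes V: "V \<in> qborel Y \<sigma>" and m: "0 < m" and "x \<in> X" "0 < s"
    and N: "\<And>z. Some z \<in> V \<Longrightarrow> m \<le> N z" and sub: "Some -` V \<subseteq> qball X \<rho> x s"
  shows "emeasure \<nu> V \<le> ennreal (C ^ 3 * (s / m\<^sup>2) powr Q)"
proof -
  have C: "0 \<le> C" using C_ge_1 by simp
  let ?c = "C\<^sup>2 * (1 / m\<^sup>2) powr Q"
  have "dens z \<le> ennreal ?c" if "Some z \<in> V" for z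
  proof -
    have zX: "z \<in> X" using that sub by (auto simp: qball_def)
    have "(1 / (N z)\<^sup>2) powr Q \<le> (1 / m\<^sup>2) powr Q"
      using N[OF that] m Q_pos by (intro powr_mono2) (auto intro!: divide_left_mono power_mono)
    then have "C\<^sup>2 * (1 / (N z)\<^sup>2) powr Q \<le> ?c" by (intro mult_left_mono) auto
    then show ?thesis using dens_upper[OF zX] by (meson ennreal_leI order.trans)
  qed
  then have "emeasure \<nu> V \<le> (\<integral>\<^sup>+z. ennreal ?c * indicator (Some -` V) z \<partial>\<mu>)"
    unfolding emeasure_sph[OF V] by (intro nn_integral_mono) (auto simp: indicator_def)
  also have "\<dots> = ennreal ?c * emeasure \<mu> (Some -` V)"
    using vimage_Some_sets[OF V] by (rule nn_integral_cmult_indicator)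
  also have "emeasure \<mu> (Some -` V) = outer_measure_of \<mu> (Some -` V)"
    using vimage_Some_sets[OF V] by simp
  also have "\<dots> \<le> ennreal (C * s powr Q)"
    using outer_measure_of_mono[OF sub] ball_upper[OF assms(3,4)] by (rule order.trans)
  finally have "emeasure \<nu> V \<le> ennreal ?c * ennreal (C * s powr Q)"
    by (simp add: mult_left_mono)
  also have "\<dots> = ennreal (?c * (C * s powr Q))" using C by (subst ennreal_mult) auto
  also have "?c * (C * s powr Q) = C ^ 3 * ((1 / m\<^sup>2) powr Q * s powr Q)"
    by (simp add: power2_eq_square power3_eq_cube)
  also have "(1 / m\<^sup>2) powr Q * s powr Q = (s / m\<^sup>2) powr Q"
    using assms by (simp flip: powr_mult)
  finally show ?thesis .
qed

lemma emeasure_sph_ge: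
  assumes V: "V \<in> qborel Y \<sigma>" and "x \<in> X" "0 < s"
    and N: "\<And>z. Some z \<in> V \<Longrightarrow> N z \<le> m" and sub: "qball X \<rho> x s \<subseteq> Some -` V"
  shows "ennreal ((s / m\<^sup>2) powr Q / C ^ 3) \<le> emeasure \<nu> V"
proof -
  have C: "0 < C" using C_ge_1 by simp
  have "V \<subseteq> Y" using V sets.sets_into_space[of V \<nu>] by (simp add: sets_sph space_sph)
  then have VX: "z \<in> X" if "Some z \<in> V" for z using that by (auto simp: sph_carrier_def)
  have "x \<in> qball X \<rho> x s" using assms eq_0[of x x] by (simp add: qball_def)
  \<comment> \<open>Positivity of \<open>m\<close> follows because \<open>x\<close> itself lies in
    the part of \<open>V\<close> where \<open>N\<close> is at most \<open>m\<close>.\<close>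
  then have m: "0 < m" using sub N[of x] N_ge_1[OF \<open>x \<in> X\<close>] by force
  let ?c = "(1 / m\<^sup>2) powr Q / C\<^sup>2"
  have dens: "ennreal ?c \<le> dens z" if "Some z \<in> V" for z
  proof -
    have "(1 / m\<^sup>2) powr Q \<le> (1 / (N z)\<^sup>2) powr Q"
      using N[OF that] m Q_pos N_ge_1[OF VX[OF that]]
      by (intro powr_mono2 divide_left_mono power_mono) auto
    then have "?c \<le> (1 / (N z)\<^sup>2) powr Q / C\<^sup>2" by (intro divide_right_mono) auto
    then show ?thesis using dens_lower[OF VX[OF that]] by (meson ennreal_leI order.trans)
  qed
  have "(s / m\<^sup>2) powr Q = (1 / m\<^sup>2) powr Q * s powr Q"
    using assms by (simp flip: powr_mult)
  then have "(s / m\<^sup>2) powr Q / C ^ 3 = ?c * (inverse C * s powr Q)"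
    using C by (simp add: power2_eq_square power3_eq_cube field_simps)
  then have "ennreal ((s / m\<^sup>2) powr Q / C ^ 3) = ennreal ?c * ennreal (inverse C * s powr Q)"
    using C by (simp only: ennreal_mult[symmetric] zero_le_mult_iff zero_le_divide_iff) (simp add: ennreal_mult[symmetric])
  also have "ennreal (inverse C * s powr Q) \<le> outer_measure_of \<mu> (Some -` V)"
    using ball_lower[OF assms(2,3)] outer_measure_of_mono[OF sub] by (rule order.trans)
  also have "outer_measure_of \<mu> (Some -` V) = emeasure \<mu> (Some -` V)"
    using vimage_Some_sets[OF V] by simp
  also have "ennreal ?c * emeasure \<mu> (Some -` V) = (\<integral>\<^sup>+z. ennreal ?c * indicator (Some -` V) z \<partial>\<mu>)"
    using vimage_Some_sets[OF V] by (rule nn_integral_cmult_indicator[symmetric])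
  also have "\<dots> \<le> emeasure \<nu> V"
    unfolding emeasure_sph[OF V] using dens by (intro nn_integral_mono) (auto simp: indicator_def)
  finally show ?thesis by (simp add: mult_left_mono)
qed

text \<open>\<open>open_between_qballs\<close> for the constant \<open>4 * K\<^sup>2\<close> of
  \<sigma>, rescaled so that the inner radius is \<open>R\<close>.\<close>

lemma open_between_sph:
  assumes "x \<in> Y" "0 < R"
  obtains V where "V \<in> qborel Y \<sigma>"
    "qball Y \<sigma> x R \<subseteq> V" "V \<subseteq> qball Y \<sigma> x (4 * K\<^sup>2 * R)"
proof -
  have "0 < 4 * K\<^sup>2 * R" using K_ge_1 assms by simp
  from open_between_qballs[OF quasi_metric_sph assms(1) this] obtain V
    where "openin (qtopology Y \<sigma>) V" "qball Y \<sigma> x (4 * K\<^sup>2 * R / (4 * K\<^sup>2)) \<subseteq> V"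
      "V \<subseteq> qball Y \<sigma> x (4 * K\<^sup>2 * R)" by blast
  moreover have "4 * K\<^sup>2 * R / (4 * K\<^sup>2) = R" using K_ge_1 by simp
  ultimately show ?thesis using that qborel_openin by metis
qed

text \<open>The open set reaches out to radius \<open>4 * K\<^sup>2 * R\<close>, and the smallness
  condition at that radius is the one with \<open>16 * K ^ 4\<close>. In
  \<open>emeasure_sph_le\<close> the factors \<open>(N x)\<^sup>2\<close> of \<open>s\<close> and
  \<open>m\<^sup>2\<close> cancel, leaving \<open>8 * K ^ 3 * R\<close> times
  \<open>4 * K\<^sup>2\<close>.\<close>

lemma near_ball_upper:
  assumes "x \<in> X" "0 < R" "16 * K ^ 4 * R * N x \<le> 1"
  shows "outer_measure_of \<nu> (qball Y \<sigma> (Some x) R) \<le> ennreal (C ^ 3 * (32 * K ^ 5 * R) powr Q)"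
proof -
  have K: "1 \<le> K" by (rule K_ge_1)
  have Nx: "1 \<le> N x" using N_ge_1 assms by auto
  have xY: "Some x \<in> Y" using assms by (simp add: sph_carrier_def)
  let ?R = "4 * K\<^sup>2 * R"
  have R: "4 * K\<^sup>2 * ?R * N x \<le> 1" using assms(3) by (simp add: power2_eq_square power4_eq_xxxx)
  obtain V where V: "V \<in> qborel Y \<sigma>" "qball Y \<sigma> (Some x) R \<subseteq> V" "V \<subseteq> qball Y \<sigma> (Some x) ?R"
    using open_between_sph[OF xY assms(2)] by blast
  have VX: "z \<in> X" "\<sigma> (Some x) (Some z) < ?R" if "Some z \<in> V" for z
    using that V(3) by (auto simp: qball_def sph_carrier_def)
  have "outer_measure_of \<nu> (qball Y \<sigma> (Some x) R) \<le> outer_measure_of \<nu> V"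
    using V(2) by (rule outer_measure_of_mono)
  also have "\<dots> = emeasure \<nu> V" using V(1) by (simp add: sets_sph)
  also have "\<dots> \<le> ennreal (C ^ 3 * ((2 * K * ?R * (N x)\<^sup>2) / (N x / (2 * K))\<^sup>2) powr Q)"
  proof (rule emeasure_sph_le[OF V(1) _ assms(1)])
    show "0 < N x / (2 * K)" "0 < 2 * K * ?R * (N x)\<^sup>2" using Nx K assms(2) by auto
    show "N x / (2 * K) \<le> N z" if "Some z \<in> V" for z
      using near_N_ge[OF assms(1) VX[OF that] R] K by (simp add: divide_le_eq mult.commute)
    show "Some -` V \<subseteq> qball X \<rho> x (2 * K * ?R * (N x)\<^sup>2)"
      using near_dist[OF assms(1) VX R] VX by (auto simp: qball_def)
  qed
  finally have le: "outer_measure_of \<nu> (qball Y \<sigma> (Some x) R)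
    \<le> ennreal (C ^ 3 * ((2 * K * ?R * (N x)\<^sup>2) / (N x / (2 * K))\<^sup>2) powr Q)" .
  have "(2 * K * ?R * n\<^sup>2) / (n / (2 * K))\<^sup>2 = 32 * K ^ 5 * R" if "n \<noteq> 0" for n
    using that K by (simp add: field_simps eval_nat_numeral)
  then have "(2 * K * ?R * (N x)\<^sup>2) / (N x / (2 * K))\<^sup>2 = 32 * K ^ 5 * R" using Nx by auto
  with le show ?thesis by (simp only:)
qed

text \<open>Here the open set lies between the radii \<open>R / (4 * K\<^sup>2)\<close> and
  \<open>R\<close>; \<open>near_converse\<close> is used at the inner radius and
  \<open>near_N_le\<close> at the outer one. Again \<open>N x\<close> cancels from
  \<open>s / m\<^sup>2\<close>.\<close>

lemma near_ball_lower:
  assumes "x \<in> X" "0 < R" "4 * K\<^sup>2 * R * N x \<le> 1"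
  shows "ennreal ((R / (32 * K ^ 5)) powr Q / C ^ 3) \<le> outer_measure_of \<nu> (qball Y \<sigma> (Some x) R)"
proof -
  have K: "1 \<le> K" by (rule K_ge_1)
  have Nx: "1 \<le> N x" using N_ge_1 assms by auto
  have xY: "Some x \<in> Y" using assms by (simp add: sph_carrier_def)
  let ?R = "R / (4 * K\<^sup>2)"
  have R0: "0 < ?R" using assms K by simp
  have "?R \<le> 4 * K\<^sup>2 * R"
  proof -
    have "1 * 1 \<le> (4 * K\<^sup>2) * (4 * K\<^sup>2)" using K by (intro mult_mono) (auto intro: order.trans[of 1 "K\<^sup>2"])
    then have "1 * R \<le> ((4 * K\<^sup>2) * (4 * K\<^sup>2)) * R" using assms by (intro mult_right_mono) auto
    then show ?thesis using K by (simp add: divide_le_eq mult_ac)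
  qed
  then have "?R * N x \<le> 4 * K\<^sup>2 * R * N x" using Nx by (intro mult_right_mono) auto
  then have R1: "?R * N x \<le> 1" using assms(3) by linarith
  have "4 * K\<^sup>2 * ?R = R" using K by simp
  then obtain V where V: "V \<in> qborel Y \<sigma>" "qball Y \<sigma> (Some x) ?R \<subseteq> V" "V \<subseteq> qball Y \<sigma> (Some x) R"
    using open_between_sph[OF xY R0] by metis
  have VX: "z \<in> X" "\<sigma> (Some x) (Some z) < R" if "Some z \<in> V" for z
    using that V(3) by (auto simp: qball_def sph_carrier_def)
  have "(?R * n\<^sup>2 / (2 * K)) / (2 * K * n)\<^sup>2 = R / (32 * K ^ 5)" if "n \<noteq> 0" for n
    using that K by (simp add: field_simps eval_nat_numeral)
  then have "(?R * (N x)\<^sup>2 / (2 * K)) / (2 * K * N x)\<^sup>2 = R / (32 * K ^ 5)" using Nx by auto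
  moreover have "ennreal (((?R * (N x)\<^sup>2 / (2 * K)) / (2 * K * N x)\<^sup>2) powr Q / C ^ 3) \<le> emeasure \<nu> V"
  proof (rule emeasure_sph_ge[OF V(1) assms(1)])
    show "0 < ?R * (N x)\<^sup>2 / (2 * K)" 
    proof -
      have "0 < (N x)\<^sup>2" using Nx by (intro zero_less_power) linarith
      then show ?thesis using R0 K assms(2) by (intro divide_pos_pos mult_pos_pos) auto
    qed
    show "N z \<le> 2 * K * N x" if "Some z \<in> V" for z
      using near_N_le[OF assms(1) VX[OF that] assms(3)] .
    show "qball X \<rho> x (?R * (N x)\<^sup>2 / (2 * K)) \<subseteq> Some -` V"
    proof
      fix z assume "z \<in> qball X \<rho> x (?R * (N x)\<^sup>2 / (2 * K))"
      then have "z \<in> X" "\<rho> x z < ?R * (N x)\<^sup>2 / (2 * K)" by (auto simp: qball_def)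
      with near_converse[OF assms(1) _ R1] have "Some z \<in> qball Y \<sigma> (Some x) ?R"
        by (simp add: qball_def sph_carrier_def)
      then show "z \<in> Some -` V" using V(2) by blast
    qed
  qed
  moreover have "emeasure \<nu> V = outer_measure_of \<nu> V" using V(1) by (simp add: sets_sph)
  ultimately show ?thesis using outer_measure_of_mono[OF V(3), of \<nu>] by simp
qed

section \<open>Balls around infinity\<close>

lemma half_powr_Q_less_1: "(1 / 2 :: real) powr Q < 1"
proof -
  have "(1 / 2 :: real) powr Q < 1 powr Q" using Q_pos by (intro powr_less_mono2) auto
  then show ?thesis by (simp only: powr_one_eq_one)
qed

text \<open>The series adds up the dyadic contributions in \<open>infinity_ball_upper\<close>, whose
  ratio is \<open>(1 / 2) powr Q\<close>. The factor \<open>16 * K ^ 3\<close> is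
  \<open>4 * K / t\<close> divided by \<open>R\<close>, for the \<open>t\<close> of that
  proof.\<close>

definition "infinity_const = C ^ 3 * (16 * K ^ 3) powr Q * (\<Sum>k. ((1 / 2) powr Q) ^ k)"

text \<open>The density is majorised by a countable combination of indicators of open sets
  \<open>W k\<close> around \<open>a\<close> of radius about \<open>2 ^ k * t\<close>. Doubling the
  radius multiplies the density bound by 2 to the power \<open>-2 * Q\<close> and the measure bound
  by 2 to the power \<open>Q\<close>, so the terms form a convergent geometric series.\<close>

lemma infinity_ball_upper:
  assumes R: "0 < R"
  shows "outer_measure_of \<nu> (qball Y \<sigma> None R) \<le> ennreal (infinity_const * R powr Q)"
proof -
  have K: "1 \<le> K" by (rule K_ge_1)
  have C: "0 < C" using C_ge_1 by simp
  \<comment> \<open>The finite points within spherical distance \<open>4 * K\<^sup>2 * R\<close> of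
    infinity are exactly those with \<open>N z > t\<close>.\<close>
  define t where "t = 1 / (4 * K\<^sup>2 * R)"
  have t: "0 < t" using K R by (simp add: t_def)
  obtain V where V: "V \<in> qborel Y \<sigma>" "qball Y \<sigma> None R \<subseteq> V" "V \<subseteq> qball Y \<sigma> None (4 * K\<^sup>2 * R)"
  proof -
    have "None \<in> Y" by (simp add: sph_carrier_def)
    from open_between_sph[OF this R] show ?thesis using that by blast
  qed
  have VX: "z \<in> X" and VN: "t < N z" if "Some z \<in> V" for z
  proof -
    show z: "z \<in> X" using that V(3) by (auto simp: qball_def sph_carrier_def)
    have "1 / N z < 4 * K\<^sup>2 * R" using that V(3) by (auto simp: qball_def)
    then show "t < N z" using N_ge_1[OF z] K R by (simp add: t_def divide_less_eq mult.commute)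
  qed
  have "\<exists>U. openin (qtopology X \<rho>) U \<and> qball X \<rho> a (2 ^ k * t) \<subseteq> U \<and> U \<subseteq> qball X \<rho> a (K * (2 ^ k * t))"
    for k :: nat
  proof -
    have "0 < K * (2 ^ k * t)" using K t by simp
    from open_between_qballs[OF qm a_in this] show ?thesis using K by (metis nonzero_mult_div_cancel_left not_one_le_zero)
  qed
  then obtain W where W: "\<And>k::nat. openin (qtopology X \<rho>) (W k)"
    and W_sup: "\<And>k. qball X \<rho> a (2 ^ k * t) \<subseteq> W k"
    and W_sub: "\<And>k. W k \<subseteq> qball X \<rho> a (K * (2 ^ k * t))" by metis
  have Wm: "W k \<in> sets \<mu>" for k using W qborel_openin qborel_sets by blast
  define c where "c k = C\<^sup>2 * (1 / (2 ^ k * t / 2)\<^sup>2) powr Q" for k :: nat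
  have dens: "dens z \<le> (\<Sum>k. ennreal (c k) * indicator (W k) z)" if zV: "Some z \<in> V" for z
  proof -
    have zX: "z \<in> X" using VX zV .
    define P where "P k \<longleftrightarrow> \<rho> a z < 2 ^ k * t" for k :: nat
    obtain n where "\<rho> a z / t < 2 ^ n" using real_arch_pow[of 2 "\<rho> a z / t"] by auto
    then have Pn: "P n" using t by (simp add: P_def divide_less_eq)
    \<comment> \<open>For the least \<open>k\<close> with \<open>\<rho> a z < 2 ^ k * t\<close>,
      minimality gives \<open>2 ^ k * t / 2 \<le> N z\<close> if \<open>k > 0\<close>, and
      \<open>t < N z\<close> gives it if \<open>k = 0\<close>. Hence the halved radius in
      \<open>c\<close>.\<close>
    define k where "k = (LEAST k. P k)"
    have Pk: "P k" unfolding k_def using Pn by (rule LeastI)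
    then have zW: "z \<in> W k" using W_sup[of k] zX by (auto simp: P_def qball_def)
    have Nz: "2 ^ k * t / 2 \<le> N z"
    proof (cases k)
      case 0
      then show ?thesis using VN[OF zV] t by simp
    next
      case (Suc j)
      then have "\<not> P j" using not_less_Least[of j P] by (simp add: k_def)
      then show ?thesis using Suc comm[OF a_in zX] by (simp add: P_def)
    qed
    have "(1 / (N z)\<^sup>2) powr Q \<le> (1 / (2 ^ k * t / 2)\<^sup>2) powr Q"
      using Nz t Q_pos N_ge_1[OF zX] by (intro powr_mono2 divide_left_mono power_mono mult_pos_pos) auto
    then have "C\<^sup>2 * (1 / (N z)\<^sup>2) powr Q \<le> c k" unfolding c_def by (intro mult_left_mono) auto
    then have "dens z \<le> ennreal (c k)" using dens_upper[OF zX] by (meson ennreal_leI order.trans)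
    define f where "f = (\<lambda>k. ennreal (c k) * indicator (W k) z)"
    note \<open>dens z \<le> ennreal (c k)\<close>
    also have "ennreal (c k) = f k" using zW by (simp add: f_def)
    also have "\<dots> \<le> suminf f" using sum_le_suminf[OF summableI, of "{k}" f] by simp
    finally show ?thesis by (simp only: f_def)
  qed
  have q: "0 < (1 / 2 :: real) powr Q" "(1 / 2 :: real) powr Q < 1"
    using half_powr_Q_less_1 by simp_all
  have summand: "ennreal (c k) * emeasure \<mu> (W k)
      \<le> ennreal (C ^ 3 * (4 * K / t) powr Q * ((1 / 2) powr Q) ^ k)" for k
  proof -
    have "emeasure \<mu> (W k) = outer_measure_of \<mu> (W k)" using Wm by simp
    also have "\<dots> \<le> outer_measure_of \<mu> (qball X \<rho> a (K * (2 ^ k * t)))"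
      using W_sub by (rule outer_measure_of_mono)
    also have "\<dots> \<le> ennreal (C * (K * (2 ^ k * t)) powr Q)"
      using K t by (intro ball_upper a_in) simp
    finally have "ennreal (c k) * emeasure \<mu> (W k) \<le> ennreal (c k) * ennreal (C * (K * (2 ^ k * t)) powr Q)"
      by (rule mult_left_mono) simp
    also have "\<dots> = ennreal (c k * (C * (K * (2 ^ k * t)) powr Q))"
      using C by (simp add: c_def ennreal_mult)
    also have "c k * (C * (K * (2 ^ k * t)) powr Q)
        = C ^ 3 * ((1 / (2 ^ k * t / 2)\<^sup>2) powr Q * (K * (2 ^ k * t)) powr Q)"
      by (simp add: c_def power2_eq_square power3_eq_cube)
    also have "(1 / (2 ^ k * t / 2)\<^sup>2) powr Q * (K * (2 ^ k * t)) powr Q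
        = ((1 / (2 ^ k * t / 2)\<^sup>2) * (K * (2 ^ k * t))) powr Q"
      by (rule powr_mult[symmetric])
    also have "(1 / (2 ^ k * t / 2)\<^sup>2) * (K * (2 ^ k * t)) = (4 * K / t) * (1 / 2) ^ k"
      using t by (simp add: power2_eq_square field_simps)
    also have "((4 * K / t) * (1 / 2) ^ k) powr Q = (4 * K / t) powr Q * ((1 / 2) powr Q) ^ k"
    proof -
      have "((1 / 2 :: real) ^ k) powr Q = ((1 / 2) powr Q) ^ k"
        by (induction k) (simp_all only: power_0 power_Suc powr_mult powr_one_eq_one)
      then show ?thesis by (simp only: powr_mult)
    qed
    finally show ?thesis by (simp add: mult.assoc)
  qed
  have "outer_measure_of \<nu> (qball Y \<sigma> None R) \<le> outer_measure_of \<nu> V"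
    using V(2) by (rule outer_measure_of_mono)
  also have "\<dots> = emeasure \<nu> V" using V(1) by (simp add: sets_sph)
  also have "\<dots> \<le> (\<integral>\<^sup>+z. (\<Sum>k. ennreal (c k) * indicator (W k) z) \<partial>\<mu>)"
    unfolding emeasure_sph[OF V(1)] using dens by (intro nn_integral_mono) (auto simp: indicator_def)
  also have "\<dots> = (\<Sum>k. ennreal (c k) * emeasure \<mu> (W k))"
    using Wm by (subst nn_integral_suminf) (auto simp: nn_integral_cmult_indicator)
  also have "\<dots> \<le> (\<Sum>k. ennreal (C ^ 3 * (4 * K / t) powr Q * ((1 / 2) powr Q) ^ k))"
    using summand by (intro suminf_le) auto
  also have "\<dots> = ennreal (\<Sum>k. C ^ 3 * (4 * K / t) powr Q * ((1 / 2) powr Q) ^ k)"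
    using C q by (intro suminf_ennreal2 summable_mult summable_geometric) auto
  also have "(\<Sum>k. C ^ 3 * (4 * K / t) powr Q * ((1 / 2) powr Q) ^ k)
      = C ^ 3 * (4 * K / t) powr Q * (\<Sum>k. ((1 / 2) powr Q) ^ k)"
    using q by (intro suminf_mult summable_geometric) auto
  also have "(4 * K / t) powr Q = (16 * K ^ 3) powr Q * R powr Q"
    using K R by (simp add: t_def power2_eq_square power3_eq_cube mult.assoc flip: powr_mult)
  finally show ?thesis by (simp add: infinity_const_def mult_ac)
qed

lemma infinity_const_nonneg: "0 \<le> infinity_const"
proof -
  have "summable (\<lambda>k. ((1 / 2 :: real) powr Q) ^ k)"
    using half_powr_Q_less_1 by (intro summable_geometric) simp
  then show ?thesis
    using C_ge_1 unfolding infinity_const_def by (intro mult_nonneg_nonneg suminf_nonneg) auto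
qed

section \<open>Upper bound for all spherical balls\<close>

lemma sph_ball_upper:
  obtains E where "\<And>x R. \<lbrakk>x \<in> Y; 0 < R\<rbrakk> \<Longrightarrow> outer_measure_of \<nu> (qball Y \<sigma> x R) \<le> ennreal (E * R powr Q)"
proof
  let ?A = "C ^ 3 * (32 * K ^ 5) powr Q" and ?I = infinity_const
  \<comment> \<open>The sum of the constants of the three cases dominates each of them.\<close>
  let ?E = "?A + ?I + ?I * (64 * K ^ 6) powr Q"
  have K: "1 \<le> K" by (rule K_ge_1)
  have nn: "0 \<le> ?A" "0 \<le> ?I" "0 \<le> ?I * (64 * K ^ 6) powr Q"
    using C_ge_1 infinity_const_nonneg by auto
  fix x R assume x: "x \<in> Y" and R: "0 < (R :: real)"
  have E: "m \<le> ennreal (?E * R powr Q)" if "m \<le> ennreal (e * R powr Q)" "e \<le> ?E" for m e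
    using that by (meson ennreal_leI mult_right_mono order.trans powr_ge_zero)
  consider "x = None" | y where "x = Some y" "y \<in> X" "16 * K ^ 4 * R * N y \<le> 1"
    | y where "x = Some y" "y \<in> X" "1 < 16 * K ^ 4 * R * N y"
    using x by (force simp: sph_carrier_def)
  then show "outer_measure_of \<nu> (qball Y \<sigma> x R) \<le> ennreal (?E * R powr Q)"
  proof cases
    case 1
    show ?thesis unfolding 1 by (rule E[OF infinity_ball_upper[OF R]]) (use nn in linarith)
  next
    case 2
    have "C ^ 3 * (32 * K ^ 5 * R) powr Q = ?A * R powr Q" by (simp only: powr_mult mult.assoc)
    then have "outer_measure_of \<nu> (qball Y \<sigma> x R) \<le> ennreal (?A * R powr Q)"
      using near_ball_upper[OF 2(2) R 2(3)] unfolding 2(1) by (simp only:)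
    then show ?thesis by (rule E) (use nn in linarith)
  next
    case 3
    have "0 < N y" using N_ge_1[OF 3(2)] by linarith
    \<comment> \<open>A radius too large for \<open>near_ball_upper\<close> means that
      \<open>x\<close> is close to infinity on the scale \<open>R\<close>. One quasi-triangle
      inequality then puts the ball inside a ball around infinity.\<close>
    then have y: "\<sigma> None x < 16 * K ^ 4 * R" using 3 by (simp add: divide_less_eq)
    have "1 \<le> K ^ 4" using K by simp
    then have "1 * R \<le> 16 * K ^ 4 * R" using R by (intro mult_right_mono) auto
    then have R16: "R \<le> 16 * K ^ 4 * R" by simp
    have "qball Y \<sigma> x R \<subseteq> qball Y \<sigma> None (64 * K ^ 6 * R)"
    proof
      fix z assume z: "z \<in> qball Y \<sigma> x R"
      then have zY: "z \<in> Y" by (simp add: qball_def)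
      have "\<sigma> None z \<le> 4 * K\<^sup>2 * max (\<sigma> None x) (\<sigma> x z)"
        using sigma_triangle[OF _ x zY] by (simp add: sph_carrier_def)
      also have "\<dots> < 4 * K\<^sup>2 * (16 * K ^ 4 * R)"
        using z y R16 K by (intro mult_strict_left_mono) (auto simp: qball_def)
      also have "\<dots> = 64 * K ^ 6 * R" by (simp add: eval_nat_numeral)
      finally show "z \<in> qball Y \<sigma> None (64 * K ^ 6 * R)" using zY by (simp add: qball_def)
    qed
    then have "outer_measure_of \<nu> (qball Y \<sigma> x R) \<le> outer_measure_of \<nu> (qball Y \<sigma> None (64 * K ^ 6 * R))"
      by (rule outer_measure_of_mono)
    also have "\<dots> \<le> ennreal (?I * (64 * K ^ 6 * R) powr Q)"
      using K R by (intro infinity_ball_upper) simp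
    also have "?I * (64 * K ^ 6 * R) powr Q = ?I * (64 * K ^ 6) powr Q * R powr Q"
      by (simp only: powr_mult mult.assoc)
    finally show ?thesis by (rule E) (use nn in linarith)
  qed
qed

section \<open>Lower bound for all spherical balls\<close>

text \<open>If the annulus were empty, the balls of radii \<open>t\<close> and \<open>M * t\<close>
  around \<open>a\<close> would coincide, and regularity would force
  \<open>M powr Q \<le> C\<^sup>2\<close>. The choice \<open>M powr Q = C\<^sup>2 + 1\<close> rules
  this out.\<close>

lemma annulus_point:
  obtains M where "1 \<le> M" "\<And>t. 0 < t \<Longrightarrow> \<exists>y\<in>X. t \<le> \<rho> y a \<and> \<rho> y a < M * t"
proof
  let ?M = "(C\<^sup>2 + 1) powr (1 / Q)"
  have C: "0 < C" using C_ge_1 by simp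
  have "1 \<le> C\<^sup>2 + 1" by simp
  then show M: "1 \<le> ?M" using Q_pos by (intro ge_one_powr_ge_zero) auto
  have MQ: "?M powr Q = C\<^sup>2 + 1" using Q_pos by (simp add: powr_powr add_nonneg_pos)
  fix t :: real assume t: "0 < t"
  show "\<exists>y\<in>X. t \<le> \<rho> y a \<and> \<rho> y a < ?M * t"
  proof (rule ccontr)
    assume "\<not> ?thesis"
    then have sub: "qball X \<rho> a (?M * t) \<subseteq> qball X \<rho> a t"
      using comm a_in by (auto simp: qball_def not_le)
    have Mt: "0 < ?M * t" using M t by (intro mult_pos_pos) linarith
    have "ennreal (inverse C * (?M * t) powr Q) \<le> outer_measure_of \<mu> (qball X \<rho> a (?M * t))"
      using a_in Mt by (rule ball_lower)
    also have "\<dots> \<le> outer_measure_of \<mu> (qball X \<rho> a t)" using sub by (rule outer_measure_of_mono)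
    also have "\<dots> \<le> ennreal (C * t powr Q)" using a_in t by (rule ball_upper)
    finally have "inverse C * (?M * t) powr Q \<le> C * t powr Q" using C by (simp add: ennreal_le_iff)
    then have "inverse C * (C\<^sup>2 + 1) * t powr Q \<le> C * t powr Q"
      by (simp only: powr_mult MQ mult.assoc)
    then have "inverse C * (C\<^sup>2 + 1) \<le> C" using t by simp
    then show False using C by (simp add: field_simps power2_eq_square)
  qed
qed

text \<open>Reduces lower bounds to finite centres \<open>y\<close> with \<open>R * N y\<close>
  bounded. If \<open>R * N x\<close> is bounded, \<open>x\<close> itself serves. Otherwise infinity
  is within \<open>R / (4 * K\<^sup>2)\<close> of \<open>x\<close>, and a point \<open>y\<close>
  with \<open>\<rho> y a\<close> about \<open>16 * K ^ 4 / R\<close> is so close to infinity that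
  two quasi-triangle inequalities, each costing \<open>4 * K\<^sup>2\<close>, suffice.\<close>

lemma inner_ball:
  obtains M where "1 \<le> M"
    "\<And>x R. \<lbrakk>x \<in> Y; 0 < R; R \<le> K\<rbrakk> \<Longrightarrow>
      \<exists>y\<in>X. R * N y \<le> M \<and> qball Y \<sigma> (Some y) (R / (16 * K ^ 4)) \<subseteq> qball Y \<sigma> x R"
proof -
  obtain M where M: "1 \<le> M" and annulus: "\<And>t. 0 < t \<Longrightarrow> \<exists>y\<in>X. t \<le> \<rho> y a \<and> \<rho> y a < M * t"
    using annulus_point by blast
  have K: "1 \<le> K" by (rule K_ge_1)
  let ?L = "16 * K ^ 4"
  \<comment> \<open>The summand \<open>4 * K\<^sup>2\<close> covers the case \<open>y = x\<close>;
    the other two bound \<open>R + M * ?L\<close> for a point of the annulus, using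
    \<open>R \<le> K\<close>.\<close>
  let ?M = "4 * K\<^sup>2 + K + M * ?L"
  have K4: "1 \<le> K ^ 4" "1 \<le> K\<^sup>2" using K by auto
  have prod_nn: "0 \<le> M * ?L" using M K4 by (intro mult_nonneg_nonneg) auto
  show ?thesis
  proof (rule that)
    show "1 \<le> ?M" using K4 K prod_nn by linarith
    fix x R assume x: "x \<in> Y" and R: "0 < R" "R \<le> K"
    consider y where "x = Some y" "y \<in> X" "R * N y \<le> 4 * K\<^sup>2"
      | "\<sigma> x None < R / (4 * K\<^sup>2)"
    proof (cases x)
      case None
      then show ?thesis using that(2) R K by simp
    next
      case (Some y)
      then have y: "y \<in> X" using x by (auto simp: sph_carrier_def)
      show ?thesis
      proof (cases "R * N y \<le> 4 * K\<^sup>2")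
        case True
        then show ?thesis using that(1) Some y by blast
      next
        case False
        then have "\<sigma> x None < R / (4 * K\<^sup>2)"
          using N_ge_1[OF y] K Some by (simp add: divide_simps mult.commute)
        then show ?thesis using that(2) by blast
      qed
    qed
    then show "\<exists>y\<in>X. R * N y \<le> ?M \<and> qball Y \<sigma> (Some y) (R / ?L) \<subseteq> qball Y \<sigma> x R"
    proof cases
      case (1 y)
      have "R / ?L \<le> R / 1" using R K4 by (intro divide_left_mono) auto
      then have "qball Y \<sigma> (Some y) (R / ?L) \<subseteq> qball Y \<sigma> x R" using 1 by (auto simp: qball_def)
      moreover have "R * N y \<le> ?M" using 1 prod_nn K by linarith
      ultimately show ?thesis using 1 by blast
    next
      case 2
      have "0 < ?L / R" using R K4 by (intro divide_pos_pos) auto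
      then obtain y where y: "y \<in> X" "?L / R \<le> \<rho> y a" "\<rho> y a < M * (?L / R)" using annulus by blast
      have yY: "Some y \<in> Y" and nY: "None \<in> Y" using y by (auto simp: sph_carrier_def)
      have "R * N y \<le> R * (1 + M * (?L / R))" using y R by (intro mult_left_mono) auto
      also have "\<dots> = R + M * ?L" using R by (simp add: field_simps)
      finally have "R * N y \<le> ?M" using R K4 by linarith
      moreover have "qball Y \<sigma> (Some y) (R / ?L) \<subseteq> qball Y \<sigma> x R"
      proof
        fix z assume z: "z \<in> qball Y \<sigma> (Some y) (R / ?L)"
        then have zY: "z \<in> Y" by (simp add: qball_def)
        have "?L / R < N y" using y by simp
        then have "1 / N y < R / ?L" using R K4 N_ge_1[OF y(1)]
          by (simp add: divide_simps mult.commute)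
        then have *: "\<sigma> None (Some y) < R / ?L" by simp
        have "\<sigma> None z \<le> 4 * K\<^sup>2 * max (\<sigma> None (Some y)) (\<sigma> (Some y) z)"
          using nY yY zY by (rule sigma_triangle)
        also have "\<dots> < 4 * K\<^sup>2 * (R / ?L)"
          using * z K by (intro mult_strict_left_mono) (auto simp: qball_def)
        also have "\<dots> = R / (4 * K\<^sup>2)" using K by (simp add: field_simps eval_nat_numeral)
        finally have **: "\<sigma> None z < R / (4 * K\<^sup>2)" .
        have "\<sigma> x z \<le> 4 * K\<^sup>2 * max (\<sigma> x None) (\<sigma> None z)"
          using x nY zY by (rule sigma_triangle)
        also have "\<dots> < 4 * K\<^sup>2 * (R / (4 * K\<^sup>2))"
          using ** 2 K by (intro mult_strict_left_mono) auto
        also have "\<dots> = R" using K by simp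
        finally show "z \<in> qball Y \<sigma> x R" using zY by (simp add: qball_def)
      qed
      ultimately show ?thesis using y(1) by blast
    qed
  qed
qed

lemma sph_ball_lower:
  obtains c where "0 < c"
    "\<And>x R. \<lbrakk>x \<in> Y; 0 < R; R \<le> K\<rbrakk> \<Longrightarrow> ennreal (c * R powr Q) \<le> outer_measure_of \<nu> (qball Y \<sigma> x R)"
proof -
  obtain M where M: "1 \<le> M" and inner: "\<And>x R. \<lbrakk>x \<in> Y; 0 < R; R \<le> K\<rbrakk> \<Longrightarrow>
      \<exists>y\<in>X. R * N y \<le> M \<and> qball Y \<sigma> (Some y) (R / (16 * K ^ 4)) \<subseteq> qball Y \<sigma> x R"
    using inner_ball by blast
  have K: "1 \<le> K" by (rule K_ge_1)
  have C: "0 < C" using C_ge_1 by simp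
  \<comment> \<open>Shrinking the radius to \<open>R / D\<close> meets two demands: it is at most
    \<open>R / (16 * K ^ 4)\<close>, and it satisfies the smallness condition of
    \<open>near_ball_lower\<close> at \<open>y\<close>.\<close>
  define D where "D = 16 * K ^ 4 * M"
  have K4: "1 \<le> K ^ 4" "1 \<le> K\<^sup>2" using K by auto
  have D0: "0 < D" using K4 M unfolding D_def by (intro mult_pos_pos) auto
  have D1: "16 * K ^ 4 \<le> D"
    using mult_left_mono[OF M, of "16 * K ^ 4"] K4 by (simp add: D_def)
  have "K\<^sup>2 \<le> K ^ 4" using K by (intro power_increasing) auto
  then have "4 * K\<^sup>2 \<le> 16 * K ^ 4" using K4 by linarith
  then have D2: "4 * K\<^sup>2 * M \<le> D" using M unfolding D_def by (intro mult_right_mono) auto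
  show ?thesis
  proof (rule that)
    show "0 < (1 / (D * (32 * K ^ 5))) powr Q / C ^ 3" using D0 K C by simp
    fix x R assume x: "x \<in> Y" and R: "0 < R" "R \<le> K"
    obtain y where y: "y \<in> X" "R * N y \<le> M"
      and sub: "qball Y \<sigma> (Some y) (R / (16 * K ^ 4)) \<subseteq> qball Y \<sigma> x R"
      using inner[OF x R] by blast
    have RD: "0 < R / D" using R D0 by simp
    have "4 * K\<^sup>2 * (R * N y) \<le> D"
      using mult_left_mono[OF y(2), of "4 * K\<^sup>2"] D2 by simp
    then have "4 * K\<^sup>2 * (R / D) * N y \<le> 1" using D0 by (simp add: divide_le_eq mult.assoc)
    note near_ball_lower[OF y(1) RD this]
    also have "R / D / (32 * K ^ 5) = (1 / (D * (32 * K ^ 5))) * R" by simp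
    also have "\<dots> powr Q = (1 / (D * (32 * K ^ 5))) powr Q * R powr Q" by (simp only: powr_mult)
    finally have "ennreal ((1 / (D * (32 * K ^ 5))) powr Q / C ^ 3 * R powr Q)
        \<le> outer_measure_of \<nu> (qball Y \<sigma> (Some y) (R / D))" by simp
    also have "\<dots> \<le> outer_measure_of \<nu> (qball Y \<sigma> x R)"
    proof (rule outer_measure_of_mono)
      have "R / D \<le> R / (16 * K ^ 4)" using D1 K4 R by (intro divide_left_mono mult_pos_pos D0) auto
      then have "qball Y \<sigma> (Some y) (R / D) \<subseteq> qball Y \<sigma> (Some y) (R / (16 * K ^ 4))"
        by (auto simp: qball_def)
      then show "qball Y \<sigma> (Some y) (R / D) \<subseteq> qball Y \<sigma> x R" using sub by blast
    qed
    finally show "ennreal ((1 / (D * (32 * K ^ 5))) powr Q / C ^ 3 * R powr Q)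
        \<le> outer_measure_of \<nu> (qball Y \<sigma> x R)" .
  qed
qed

section \<open>Support, Borel regularity and Ahlfors regularity\<close>

text \<open>Every open set contains, around each of its points, a ball of some radius at most
  \<open>K\<close>, and \<open>sph_ball_lower\<close> makes its measure positive.\<close>

lemma qsupport_sph: "qsupport Y \<sigma> \<nu> = Y"
proof
  show "qsupport Y \<sigma> \<nu> \<subseteq> Y" by (auto simp: qsupport_def)
  obtain c where c: "0 < c"
    and lower: "\<And>x R. \<lbrakk>x \<in> Y; 0 < R; R \<le> K\<rbrakk> \<Longrightarrow>
      ennreal (c * R powr Q) \<le> outer_measure_of \<nu> (qball Y \<sigma> x R)"
    using sph_ball_lower by blast
  show "Y \<subseteq> qsupport Y \<sigma> \<nu>"
    unfolding qsupport_def
  proof (intro subsetI CollectI conjI allI impI)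
    fix x U assume x: "x \<in> Y" and U: "openin (qtopology Y \<sigma>) U \<and> x \<in> U"
    then obtain r where r: "0 < r" "qball Y \<sigma> x r \<subseteq> U" unfolding openin_qtopology by blast
    define R where "R = min r K"
    have R: "0 < R" "R \<le> K" "R \<le> r" using r K_ge_1 by (auto simp: R_def)
    have "0 < ennreal (c * R powr Q)" using c R by simp
    also have "\<dots> \<le> outer_measure_of \<nu> (qball Y \<sigma> x R)" using lower x R by blast
    also have "\<dots> \<le> outer_measure_of \<nu> U"
      using r(2) R by (intro outer_measure_of_mono) (auto simp: qball_def)
    also have "\<dots> = emeasure \<nu> U"
      using U by (intro outer_measure_of_eq) (simp add: sets_sph qborel_openin)
    finally show "0 < emeasure \<nu> U" .
  qed
qed

lemma quasi_metric_measure_space_sph: "quasi_metric_measure_space (4 * K\<^sup>2) Y \<sigma> \<nu>"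
  unfolding quasi_metric_measure_space_def
proof (intro conjI allI impI)
  fix A assume "A \<subseteq> Y"
  \<comment> \<open>The measurable sets of \<nu> are exactly the Borel sets, so a measurable hull
    attaining the outer measure is Borel.\<close>
  then show "\<exists>B\<in>qborel Y \<sigma>. A \<subseteq> B \<and> emeasure \<nu> B = outer_measure_of \<nu> A"
    using outer_measure_of_attain[of A \<nu>] unfolding sets_sph space_sph by metis
next
  show "qtopology Y \<sigma> closure_of qsupport Y \<sigma> \<nu> = Y"
    unfolding qsupport_sph using closure_of_topspace[of "qtopology Y \<sigma>"] by simp
qed (simp_all add: quasi_metric_sph sets_sph space_sph)

lemma ahlfors_regular_sph: "ahlfors_regular Q Y \<sigma> \<nu>"
proof -
  obtain c where c: "0 < c"
    and lower: "\<And>x R. \<lbrakk>x \<in> Y; 0 < R; R \<le> K\<rbrakk> \<Longrightarrow>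
      ennreal (c * R powr Q) \<le> outer_measure_of \<nu> (qball Y \<sigma> x R)"
    using sph_ball_lower by blast
  obtain E where upper: "\<And>x R. \<lbrakk>x \<in> Y; 0 < R\<rbrakk> \<Longrightarrow>
      outer_measure_of \<nu> (qball Y \<sigma> x R) \<le> ennreal (E * R powr Q)"
    using sph_ball_upper by blast
  define D where "D = max 1 (max (inverse c) E)"
  have D: "1 \<le> D" "inverse c \<le> D" "E \<le> D" by (auto simp: D_def)
  have "inverse D \<le> inverse (inverse c)" using D c by (intro le_imp_inverse_le) auto
  then have Dc: "inverse D \<le> c" by simp
  show ?thesis
    unfolding ahlfors_regular_def
  proof (intro exI[of _ D] conjI ballI allI impI D(1))
    fix x R assume x: "x \<in> Y" and "0 < R \<and> ereal R < qdiam Y \<sigma>"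
    then have R: "0 < R" "R \<le> K" using qdiam_sph_le by (auto dest: less_le_trans)
    have "ennreal (inverse D * R powr Q) \<le> ennreal (c * R powr Q)"
      using Dc by (intro ennreal_leI mult_right_mono) auto
    then show "ennreal (inverse D * R powr Q) \<le> outer_measure_of \<nu> (qball Y \<sigma> x R)"
      using lower[OF x R] by (rule order.trans)
    have "ennreal (E * R powr Q) \<le> ennreal (D * R powr Q)"
      using D by (intro ennreal_leI mult_right_mono) auto
    with upper[OF x R(1)] show "outer_measure_of \<nu> (qball Y \<sigma> x R) \<le> ennreal (D * R powr Q)"
      by (rule order.trans)
  qed
qed

end

theorem theorem3p1:
  fixes X :: "'a set" and \<rho> :: "'a \<Rightarrow> 'a \<Rightarrow> real" and \<mu> :: "'a measure"
    and a :: 'a and Q K :: real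
  assumes "Q > 0" and "K \<ge> 1"
    and "quasi_metric_measure_space K X \<rho> \<mu>"
    and "\<not> qbounded X \<rho>"
    and "ahlfors_regular Q X \<rho> \<mu>"
    and "a \<in> X"
  shows "quasi_metric_measure_space (4 * K\<^sup>2) (sph_carrier X) (sph_dist \<rho> a) (sph_measure X \<rho> \<mu> a)
    \<and> qbounded (sph_carrier X) (sph_dist \<rho> a)
    \<and> ahlfors_regular Q (sph_carrier X) (sph_dist \<rho> a) (sph_measure X \<rho> \<mu> a)"
proof -
  \<comment> \<open>With infinite diameter the regularity bounds hold for every positive radius, as
    the locale demands.\<close>
  have diam: "qdiam X \<rho> = \<infinity>" using assms(4) by (simp add: qbounded_def)
  obtain C where "1 \<le> C" and "\<And>x r. \<lbrakk>x \<in> X; 0 < r\<rbrakk> \<Longrightarrow>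
      ennreal (inverse C * r powr Q) \<le> outer_measure_of \<mu> (qball X \<rho> x r) \<and>
      outer_measure_of \<mu> (qball X \<rho> x r) \<le> ennreal (C * r powr Q)"
    using assms(5) unfolding ahlfors_regular_def diam by auto
  with assms interpret ahlfors_space X \<rho> \<mu> a Q K C
    unfolding quasi_metric_measure_space_def by unfold_locales auto
  have "qbounded (sph_carrier X) (sph_dist \<rho> a)"
    using qdiam_sph_le by (auto simp: qbounded_def intro: le_less_trans)
  then show ?thesis using quasi_metric_measure_space_sph ahlfors_regular_sph by blast
qed

end
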